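(* Let $\omega$ be a function of modulus of continuity type on $[0,2\pi]$ and let $H:(0,\pi]\to[0,\infty)$ be a function such that $$\int_{u}^{\pi}t^{-2}\omega(t)\,dt=O(H(u))\quad\text{and}\quad\int_{0}^{u}H(t)\,dt=O(uH(u))\qquad\text{for }u\in(0,\pi].$$ Let $f\in X_{\omega}$, let $r$ be a positive integer, and let the matrix $A$ be such that $$\left[\sum_{l=0}^{n}\sum_{k=l}^{r+l-1}a_{n,k}\right]^{-1}=O(1).$$ Then, for $n=0,1,2,\dots$, $$\left\|\widetilde{T}_{n,A}f(\cdot)-\widetilde{f}(\cdot)\right\|_{X}=O\left(H(A_{n,r})\,A_{n,r}\right)$$ and $$\left\|\widetilde{T}_{n,A}f(\cdot)-\widetilde{f}\left(\cdot,\tfrac{1}{r}A_{n,r}\right)\right\|_{X}=O\left(H(A_{n,r})\,A_{n,r}\right).$$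
   Context: $X$ denotes either $L^{p}$ ($1\le p\le\infty$), the space of $2\pi$-periodic real-valued functions that are Lebesgue integrable with $p$-th power over $Q=[-\pi,\pi]$ (essentially bounded if $p=\infty$), with norm $\|f\|_{L^p}=(\int_Q|f(t)|^p\,dt)^{1/p}$ for $p<\infty$ and $\|f\|_{L^\infty}=\operatorname{ess\,sup}_{t\in Q}|f(t)|$; or $C$, the space of continuous $2\pi$-periodic real-valued functions with the sup norm. For $f\in X$ with real Fourier coefficients $a_\nu(f)=\frac1\pi\int_{-\pi}^{\pi}f(t)\cos\nu t\,dt$, $b_\nu(f)=\frac1\pi\int_{-\pi}^{\pi}f(t)\sin\nu t\,dt$, the partial sums of the conjugate Fourier series are $\widetilde S_kf(x)=\sum_{\nu=1}^{k}(a_\nu(f)\sin\nu x-b_\nu(f)\cos\nu x)$ (so $\widetilde S_0f=0$). Put $\psi_x(t)=f(x+t)-f(x-t)$, and for $\epsilon>0$ $$\widetilde f(x,\epsilon)=-\frac1\pi\int_\epsilon^\pi\psi_x(t)\,\frac12\cot\frac t2\,dt,\qquad \widetilde f(x)=\lim_{\epsilon\to0^+}\widetilde f(x,\epsilon),$$ the latter existing for almost all $x$. $A=(a_{n,k})_{n,k\ge0}$ is an infinite matrix of real numbers with $a_{n,k}\ge0$ for all $n,k$, $\lim_{n\to\infty}a_{n,k}=0$ for each $k$, and $\sum_{k=0}^\infty a_{n,k}=1$ for each $n$. For a positive integer $r$, $A_{n,r}=\sum_{k=0}^\infty|a_{n,k}-a_{n,k+r}|$. Further $\widetilde T_{n,A}f(x)=\sum_{k=0}^\infty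 a_{n,k}\widetilde S_kf(x)$, $n=0,1,2,\dots$. The second conjugate modulus of continuity is $\widetilde\omega_2(f,\delta)_X=\sup_{0<t\le\delta}\|\psi_\cdot(t)\|_X$ (equal to $0$ for $\delta=0$). A function of modulus of continuity type on $[0,2\pi]$ is a nondecreasing continuous function $\omega$ with $\omega(0)=0$ and $\omega(\delta_1+\delta_2)\le\omega(\delta_1)+\omega(\delta_2)$ for all $0\le\delta_1\le\delta_2\le\delta_1+\delta_2\le2\pi$. For such $\omega$, $X_\omega=\{f\in X:\widetilde\omega_2(f,\delta)_X=O(\omega(\delta))\text{ for }\delta\in[0,2\pi]\}$. All $O$-relations are uniform over the indicated range of the variable ($u$, $\delta$, or $n=0,1,2,\dots$): the implied constants do not depend on $u$, $\delta$, $n$ (they may depend on $f,\omega,H,r,A$). *)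

theory Defs
  imports
    "HOL-Analysis.Analysis"
    "HOL-Library.Landau_Symbols"
    "HOL-Probability.Essential_Supremum"
begin

text \<open>
  An \<open>O\<close>-relation that is uniform over a set \<open>S\<close> is written below with the filter
  \<open>principal S\<close>: \<open>g \<in> O[principal S](h)\<close> says that there is one constant \<open>c > 0\<close> with
  \<open>\<bar>g s\<bar> \<le> c * \<bar>h s\<bar>\<close> for every \<open>s \<in> S\<close>.
\<close>

datatype fun_space = Lp ennreal | Cont

fun valid_space :: "fun_space \<Rightarrow> bool" where
  "valid_space (Lp p) \<longleftrightarrow> 1 \<le> p"
| "valid_space Cont \<longleftrightarrow> True"

definition periodic_2pi :: "(real \<Rightarrow> real) \<Rightarrow> bool" where
  "periodic_2pi f \<longleftrightarrow> (\<forall>x. f (x + 2 * pi) = f x)"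

definition ess_bound :: "(real \<Rightarrow> real) \<Rightarrow> ereal" where
  "ess_bound f = esssup (restrict_space lebesgue {-pi..pi}) (\<lambda>t. ereal \<bar>f t\<bar>)"

text \<open>
  Elements of \<open>L\<^sup>p\<close> are represented by (everywhere periodic) functions, not by classes modulo
  null sets.
\<close>

fun carrier_of :: "fun_space \<Rightarrow> (real \<Rightarrow> real) set" where
  "carrier_of (Lp p) =
     {f. periodic_2pi f \<and> f \<in> borel_measurable lebesgue \<and>
         (if p = \<infinity> then ess_bound f < \<infinity>
          else set_integrable lebesgue {-pi..pi} (\<lambda>t. \<bar>f t\<bar> powr enn2real p))}"
| "carrier_of Cont = {f. periodic_2pi f \<and> continuous_on UNIV f}"

text \<open>Only meaningful on \<open>carrier_of X\<close>; elsewhere the value is arbitrary.\<close>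

fun norm_of :: "fun_space \<Rightarrow> (real \<Rightarrow> real) \<Rightarrow> real" where
  "norm_of (Lp p) f =
     (if p = \<infinity> then real_of_ereal (ess_bound f)
      else (LINT t:{-pi..pi}|lebesgue. \<bar>f t\<bar> powr enn2real p) powr (1 / enn2real p))"
| "norm_of Cont f = (SUP x. \<bar>f x\<bar>)"

text \<open>
  The sense in which a function has to be defined in order to be an element of the space:
  almost everywhere for \<open>L\<^sup>p\<close>, everywhere for \<open>C\<close>.
\<close>

fun holds_in :: "fun_space \<Rightarrow> (real \<Rightarrow> bool) \<Rightarrow> bool" where
  "holds_in (Lp p) P \<longleftrightarrow> (AE x in lebesgue. P x)"
| "holds_in Cont P \<longleftrightarrow> (\<forall>x. P x)"

definition fourier_a :: "(real \<Rightarrow> real) \<Rightarrow> nat \<Rightarrow> real" where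
  "fourier_a f \<nu> = (1 / pi) * (LINT t:{-pi..pi}|lebesgue. f t * cos (real \<nu> * t))"

definition fourier_b :: "(real \<Rightarrow> real) \<Rightarrow> nat \<Rightarrow> real" where
  "fourier_b f \<nu> = (1 / pi) * (LINT t:{-pi..pi}|lebesgue. f t * sin (real \<nu> * t))"

definition conj_partial_sum :: "nat \<Rightarrow> (real \<Rightarrow> real) \<Rightarrow> real \<Rightarrow> real" where
  "conj_partial_sum k f x =
     (\<Sum>\<nu>=1..k. fourier_a f \<nu> * sin (real \<nu> * x) - fourier_b f \<nu> * cos (real \<nu> * x))"

definition psi :: "(real \<Rightarrow> real) \<Rightarrow> real \<Rightarrow> real \<Rightarrow> real" where
  "psi f x t = f (x + t) - f (x - t)"

definition conj_trunc :: "(real \<Rightarrow> real) \<Rightarrow> real \<Rightarrow> real \<Rightarrow> real" where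
  "conj_trunc f x \<epsilon> =
     - (1 / pi) * (LINT t:{\<epsilon>..pi}|lebesgue. psi f x t * (1 / 2 * cot (t / 2)))"

definition conj_fun :: "(real \<Rightarrow> real) \<Rightarrow> real \<Rightarrow> real" where
  "conj_fun f x = Lim (at_right 0) (\<lambda>\<epsilon>. conj_trunc f x \<epsilon>)"

definition summation_matrix :: "(nat \<Rightarrow> nat \<Rightarrow> real) \<Rightarrow> bool" where
  "summation_matrix a \<longleftrightarrow>
     (\<forall>n k. 0 \<le> a n k) \<and>
     (\<forall>k. (\<lambda>n. a n k) \<longlonglongrightarrow> 0) \<and>
     (\<forall>n. (\<lambda>k. a n k) sums 1)"

definition row_variation :: "(nat \<Rightarrow> nat \<Rightarrow> real) \<Rightarrow> nat \<Rightarrow> nat \<Rightarrow> real" where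
  "row_variation a n r = (\<Sum>k. \<bar>a n k - a n (k + r)\<bar>)"

definition conj_mean :: "(nat \<Rightarrow> nat \<Rightarrow> real) \<Rightarrow> nat \<Rightarrow> (real \<Rightarrow> real) \<Rightarrow> real \<Rightarrow> real" where
  "conj_mean a n f x = (\<Sum>k. a n k * conj_partial_sum k f x)"

definition conj_modulus2 :: "fun_space \<Rightarrow> (real \<Rightarrow> real) \<Rightarrow> real \<Rightarrow> real" where
  "conj_modulus2 X f \<delta> =
     (if \<delta> = 0 then 0 else (SUP t\<in>{0<..\<delta>}. norm_of X (\<lambda>x. psi f x t)))"

definition modulus_type :: "(real \<Rightarrow> real) \<Rightarrow> bool" where
  "modulus_type \<omega> \<longleftrightarrow>
     mono_on {0..2*pi} \<omega> \<and> continuous_on {0..2*pi} \<omega> \<and> \<omega> 0 = 0 \<and>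
     (\<forall>\<delta>1 \<delta>2. 0 \<le> \<delta>1 \<and> \<delta>1 \<le> \<delta>2 \<and> \<delta>2 \<le> \<delta>1 + \<delta>2 \<and> \<delta>1 + \<delta>2 \<le> 2*pi \<longrightarrow>
        \<omega> (\<delta>1 + \<delta>2) \<le> \<omega> \<delta>1 + \<omega> \<delta>2)"

definition modulus_class :: "fun_space \<Rightarrow> (real \<Rightarrow> real) \<Rightarrow> (real \<Rightarrow> real) set" where
  "modulus_class X \<omega> =
     {f \<in> carrier_of X. (\<lambda>\<delta>. conj_modulus2 X f \<delta>) \<in> O[principal {0..2*pi}](\<omega>)}"

end

theory Submission
  imports Defs
begin

text \<open>
  The theorem reduces to a scalar estimate for kernels. Put \<open>A = row_variation a n r\<close> and
  \<open>q t = (\<Sum>k. a n k * cos ((k + 1/2) * t))\<close>. The conjugate Dirichlet kernel is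
  \<open>(\<Sum>\<nu>=1..k. sin (\<nu> * t)) = cot (t / 2) / 2 - cos ((k + 1/2) * t) / (2 * sin (t / 2))\<close>. Its first part is the
  kernel of the conjugate function, so, the weights having sum 1, this part cancels in the difference:
  \<open>conj_mean a n f x - conj_fun f x = 1 / \<pi> * \<integral>\<^sub>0\<^sup>\<pi> psi f x t * q t / (2 * sin (t / 2)) dt\<close>. Truncation
  at \<open>A / r\<close> only changes the kernel by a cotangent on \<open>(0, A / r)\<close>.

  An integral of \<open>psi f x t * k t\<close> over \<open>t\<close> has norm in \<open>X\<close> at most \<open>C * \<integral> \<omega> t * \<bar>k t\<bar> dt\<close>. This is
  Minkowski's integral inequality, since the norm of \<open>psi f \<cdot> t\<close> is at most \<open>C * \<omega> t\<close>; see
  \<open>kernel_operator\<close>. With \<open>k t = 1 / t\<close> it also shows that all these integrals converge absolutely for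
  almost all \<open>x\<close> (all \<open>x\<close> in the case of \<open>C\<close>), so that the limit defining the conjugate function
  exists there, because \<open>\<integral>\<^sub>0\<^sup>\<pi> \<omega> t / t dt\<close> is finite. More precisely
  \<open>\<integral>\<^sub>0\<^sup>u \<omega> t / t dt = O(u * H u)\<close>, by Tonelli's theorem and the two conditions on \<open>H\<close>; see
  \<open>dini_integral_le\<close>.

  There remains the estimate \<open>\<integral>\<^sub>0\<^sup>\<pi> \<omega> t * \<bar>q t\<bar> / t dt = O(A * H A)\<close>, which is \<open>lag_kernel_integral_le\<close>.
  Abel summation with lag \<open>r\<close> gives \<open>\<bar>q t\<bar> * \<bar>sin (r * t / 2)\<bar> \<le> A\<close>, and trivially \<open>\<bar>q t\<bar> \<le> 1\<close>. For
  \<open>t \<le> A\<close> the latter leads to the integral of \<open>\<omega> t / t\<close>, and for \<open>A \<le> t \<le> \<pi> / r\<close> the former leads to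
  \<open>A\<close> times the integral of \<open>\<omega> t / t\<^sup>2\<close>. For \<open>r \<ge> 2\<close> the factor \<open>sin (r * t / 2)\<close> has further zeros in
  \<open>(0, \<pi>]\<close>, around which the same two bounds are used in terms of the distance \<open>s\<close> to the zero. By
  subadditivity \<open>\<omega> \<pi> \<le> 2 * \<pi> * \<omega> s / s\<close>, so the contribution of each zero is at most a constant
  multiple of the contribution of the origin.
\<close>

section \<open>Minkowski's integral inequality\<close>

text \<open>
  The graph of \<open>y \<mapsto> y powr p\<close> lies above its tangent at \<open>s\<close>; the tangent inequality is Young's
  inequality with exponents \<open>p\<close> and \<open>p / (p - 1)\<close>. All terms are kept nonnegative so that it can be
  integrated in \<open>ennreal\<close>.
\<close>

lemma powr_tangent_inequality:
  fixes p s y :: real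
  assumes p: "1 \<le> p" and "0 \<le> s" "0 \<le> y"
  shows "p * (s powr (p - 1) * y) \<le> y powr p + (p - 1) * s powr p"
proof (cases "p = 1 \<or> s = 0")
  case True
  with assms show ?thesis by (cases "s = 0"; cases "y = 0") (auto simp: powr_def)
next
  case False
  define q where "q = p / (p - 1)"
  have p1: "1 < p" and s: "0 < s" using False assms by auto
  have q: "1 / p + 1 / q = 1" "1 < q" using p1 by (auto simp: q_def field_simps)
  have "s powr (p - 1) * y \<le> (s powr (p - 1)) powr q / q + y powr p / p"
    using Youngs_inequality[of q p "s powr (p - 1)" y] p1 q assms by (simp add: add.commute)
  also have "(s powr (p - 1)) powr q = s powr p"
    using p1 by (simp add: powr_powr q_def)
  finally have "p * (s powr (p - 1) * y) \<le> p * (s powr p / q + y powr p / p)"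
    using p1 by (intro mult_left_mono) auto
  also have "\<dots> = y powr p + (p - 1) * s powr p"
    using p1 by (simp add: q_def field_simps)
  finally show ?thesis .
qed

text \<open>
  Minkowski's integral inequality: the \<open>L\<^sup>p\<close> norm of an integral is at most the integral of the
  norms, of which \<open>V\<close> is a majorant. To prove it, write \<open>\<bar>u x t\<bar> = V t * y x t\<close>, apply Jensen's inequality
  for the measure \<open>V t dt\<close> in the form of the tangent inequality, and integrate over \<open>x\<close> with
  Tonelli's theorem. Where \<open>V\<close> vanishes, \<open>u\<close> vanishes almost everywhere, so the convention
  \<open>z / 0 = 0\<close> in the quotient \<open>y\<close> is harmless.
\<close>

lemma (in pair_sigma_finite) Minkowski_integral_inequality:
  fixes u :: "'a \<Rightarrow> 'b \<Rightarrow> real" and V :: "'b \<Rightarrow> real" and p W :: real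
  assumes u [measurable]: "case_prod u \<in> borel_measurable (M1 \<Otimes>\<^sub>M M2)"
    and V [measurable]: "V \<in> borel_measurable M2"
    and p: "1 \<le> p" and V0: "\<And>t. 0 \<le> V t"
    and uV: "\<And>t. t \<in> space M2 \<Longrightarrow>
              (\<integral>\<^sup>+x. ennreal (\<bar>u x t\<bar> powr p) \<partial>M1) \<le> ennreal (V t powr p)"
    and W: "0 < W" "(\<integral>\<^sup>+t. ennreal (V t) \<partial>M2) \<le> ennreal W"
  shows "AE x in M1. integrable M2 (u x)"
    and "(\<integral>\<^sup>+x. ennreal ((LINT t|M2. \<bar>u x t\<bar>) powr p) \<partial>M1) \<le> ennreal (W powr p)"
proof -
  define y where "y x t = \<bar>u x t\<bar> / V t" for x t
  have [measurable]: "case_prod y \<in> borel_measurable (M1 \<Otimes>\<^sub>M M2)"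
    unfolding y_def by measurable
  have [measurable]: "(\<lambda>x. u x t) \<in> borel_measurable M1" if "t \<in> space M2" for t
    using that by measurable
  have [measurable]: "u x \<in> borel_measurable M2" if "x \<in> space M1" for x
    using that by measurable
  have [measurable]: "(\<lambda>t. y x t) \<in> borel_measurable M2" if "x \<in> space M1" for x
    using that by measurable
  have y0: "0 \<le> y x t" for x t by (simp add: y_def V0)
  have "AE t in M2. AE x in M1. \<bar>u x t\<bar> = V t * y x t"
  proof (rule AE_I2)
    fix t assume t: "t \<in> space M2"
    show "AE x in M1. \<bar>u x t\<bar> = V t * y x t"
    proof (cases "V t = 0")
      case True
      have "(\<integral>\<^sup>+x. ennreal (\<bar>u x t\<bar> powr p) \<partial>M1) = 0"
        using uV[OF t] True p by simp
      hence "AE x in M1. ennreal (\<bar>u x t\<bar> powr p) = 0"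
        using t by (subst (asm) nn_integral_0_iff_AE) auto
      thus ?thesis by eventually_elim (auto simp: True)
    qed (simp add: y_def)
  qed
  hence fac: "AE x in M1. AE t in M2. \<bar>u x t\<bar> = V t * y x t"
    by (subst AE_commute) auto
  \<comment> \<open>\<open>E x\<close> is the right-hand side of Jensen's inequality; by the normalisation of \<open>y\<close> its integral
      over \<open>x\<close> is at most the integral of \<open>V\<close>\<close>
  define E where "E x = (\<integral>\<^sup>+t. ennreal (V t * y x t powr p) \<partial>M2)" for x
  have [measurable]: "E \<in> borel_measurable M1" unfolding E_def by measurable
  have "(\<integral>\<^sup>+x. E x \<partial>M1) = (\<integral>\<^sup>+t. \<integral>\<^sup>+x. ennreal (V t * y x t powr p) \<partial>M1 \<partial>M2)"
    unfolding E_def by (intro Fubini'[symmetric]) measurable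
  also have "\<dots> \<le> (\<integral>\<^sup>+t. ennreal (V t) \<partial>M2)"
  proof (rule nn_integral_mono)
    fix t assume t: "t \<in> space M2"
    show "(\<integral>\<^sup>+x. ennreal (V t * y x t powr p) \<partial>M1) \<le> ennreal (V t)"
    proof (cases "V t = 0")
      case False
      hence Vt: "V t > 0" using V0[of t] by simp
      have "V t * y x t powr p = V t / V t powr p * \<bar>u x t\<bar> powr p" for x
        using Vt by (simp add: y_def powr_divide)
      hence "(\<integral>\<^sup>+x. ennreal (V t * y x t powr p) \<partial>M1)
              = (\<integral>\<^sup>+x. ennreal (V t / V t powr p) * ennreal (\<bar>u x t\<bar> powr p) \<partial>M1)"
        using Vt by (simp flip: ennreal_mult)
      also have "\<dots> = ennreal (V t / V t powr p) * (\<integral>\<^sup>+x. ennreal (\<bar>u x t\<bar> powr p) \<partial>M1)"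
        using t by (subst nn_integral_cmult) auto
      also have "\<dots> \<le> ennreal (V t / V t powr p) * ennreal (V t powr p)"
        by (intro mult_left_mono uV t) auto
      also have "\<dots> = ennreal (V t)"
        using Vt by (simp flip: ennreal_mult)
      finally show ?thesis .
    qed simp
  qed
  also note W(2)
  finally have EW: "(\<integral>\<^sup>+x. E x \<partial>M1) \<le> ennreal W" .
  hence Efin: "AE x in M1. E x \<noteq> \<infinity>"
    by (intro nn_integral_PInf_AE) (auto simp: top_unique)
  have key: "AE x in M1. integrable M2 (u x)
      \<and> ennreal ((LINT t|M2. \<bar>u x t\<bar>) powr p) \<le> ennreal (W powr (p - 1)) * E x"
    using fac Efin AE_space
  proof eventually_elim
    case (elim x)
    note [measurable] = elim(3)
    have [measurable]: "u x \<in> borel_measurable M2" "y x \<in> borel_measurable M2"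
      using elim(3) by measurable
    \<comment> \<open>for integrability, \<open>y\<close> is compared with its \<open>p\<close>-th power\<close>
    have le1: "z \<le> 1 + z powr p" if "0 \<le> z" for z :: real
    proof (cases "z \<le> 1")
      case False
      hence "z powr 1 \<le> z powr p" using p by (intro powr_mono) auto
      thus ?thesis using False by simp
    qed (use that in \<open>auto intro: add_increasing2\<close>)
    have "(\<integral>\<^sup>+t. ennreal \<bar>u x t\<bar> \<partial>M2) = (\<integral>\<^sup>+t. ennreal (V t * y x t) \<partial>M2)"
      using elim(1) by (intro nn_integral_cong_AE) auto
    also have "\<dots> \<le> (\<integral>\<^sup>+t. ennreal (V t) + ennreal (V t * y x t powr p) \<partial>M2)"
    proof (rule nn_integral_mono)
      fix t
      have "V t * y x t \<le> V t * (1 + y x t powr p)"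
        by (intro mult_left_mono le1 V0 y0)
      also have "\<dots> = V t + V t * y x t powr p" by (simp add: algebra_simps)
      finally show "ennreal (V t * y x t) \<le> ennreal (V t) + ennreal (V t * y x t powr p)"
        by (simp add: V0 ennreal_leI flip: ennreal_plus)
    qed
    also have "\<dots> = (\<integral>\<^sup>+t. ennreal (V t) \<partial>M2) + E x"
      unfolding E_def by (intro nn_integral_add) measurable
    also have "\<dots> < \<infinity>"
      using elim(2) le_less_trans[OF W(2) ennreal_less_top] by (simp add: less_top)
    finally have int: "integrable M2 (u x)" by (intro integrableI_bounded) auto
    define i where "i = (LINT t|M2. \<bar>u x t\<bar>)"
    have i: "ennreal i = (\<integral>\<^sup>+t. ennreal \<bar>u x t\<bar> \<partial>M2)"
      unfolding i_def using int by (intro nn_integral_eq_integral[symmetric]) auto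
    have i0: "0 \<le> i" unfolding i_def by simp
    \<comment> \<open>the tangent is taken at the mean value; dividing by the upper bound \<open>W\<close> instead of the exact
        mass of \<open>V\<close> costs nothing because the error has the right sign\<close>
    define s where "s = i / W"
    have s0: "0 \<le> s" using i0 W by (simp add: s_def)
    obtain e where e: "E x = ennreal e" "0 \<le> e" using elim(2) by (cases "E x") auto
    have "ennreal (p * s powr (p - 1) * i)
           = ennreal (p * s powr (p - 1)) * (\<integral>\<^sup>+t. ennreal \<bar>u x t\<bar> \<partial>M2)"
      using p i i0 by (simp add: ennreal_mult)
    also have "(\<integral>\<^sup>+t. ennreal \<bar>u x t\<bar> \<partial>M2) = (\<integral>\<^sup>+t. ennreal (V t * y x t) \<partial>M2)"
      using elim(1) by (intro nn_integral_cong_AE) auto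
    also have "ennreal (p * s powr (p - 1)) * \<dots>
                 = (\<integral>\<^sup>+t. ennreal (p * s powr (p - 1)) * ennreal (V t * y x t) \<partial>M2)"
      by (intro nn_integral_cmult[symmetric]) measurable
    also have "\<dots> \<le> (\<integral>\<^sup>+t. ennreal (V t * y x t powr p)
                           + ennreal ((p - 1) * s powr p) * ennreal (V t) \<partial>M2)"
    proof (rule nn_integral_mono)
      fix t
      have "p * s powr (p - 1) * (V t * y x t)
              \<le> V t * (y x t powr p + (p - 1) * s powr p)"
        using mult_left_mono[OF powr_tangent_inequality[OF p s0 y0] V0[of t], of x t]
        by (simp add: mult_ac)
      also have "\<dots> = V t * y x t powr p + (p - 1) * s powr p * V t"
        by (simp add: algebra_simps)
      finally show "ennreal (p * s powr (p - 1)) * ennreal (V t * y x t)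
          \<le> ennreal (V t * y x t powr p) + ennreal ((p - 1) * s powr p) * ennreal (V t)"
        using p V0 y0 by (simp add: ennreal_leI flip: ennreal_plus ennreal_mult)
    qed
    also have "\<dots> = E x + ennreal ((p - 1) * s powr p) * (\<integral>\<^sup>+t. ennreal (V t) \<partial>M2)"
      unfolding E_def by (subst nn_integral_add) (auto simp: nn_integral_cmult)
    also have "\<dots> \<le> E x + ennreal ((p - 1) * s powr p) * ennreal W"
      by (intro add_left_mono mult_left_mono W) auto
    also have "\<dots> = ennreal (e + (p - 1) * s powr p * W)"
      using p e W by (simp add: ennreal_mult)
    finally have "p * s powr (p - 1) * i \<le> e + (p - 1) * s powr p * W"
      using e p W by (subst (asm) ennreal_le_iff) auto
    moreover have "s powr (p - 1) * i = s powr p * W"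
      using powr_mult_base[OF s0, of "p - 1"] W by (simp add: s_def field_simps)
    hence "p * s powr (p - 1) * i = p * (s powr p * W)" by simp
    moreover have "(p - 1) * s powr p * W = p * (s powr p * W) - s powr p * W"
      by (simp add: algebra_simps)
    ultimately have "s powr p * W \<le> e" by linarith
    hence "W powr (p - 1) * (s powr p * W) \<le> W powr (p - 1) * e"
      by (intro mult_left_mono) auto
    also have "W powr (p - 1) * (s powr p * W) = (W * W powr (p - 1)) * s powr p"
      by (simp add: mult_ac)
    also have "W * W powr (p - 1) = W powr p"
      using W powr_mult_base[of W "p - 1"] by simp
    also have "W powr p * s powr p = i powr p"
      using W i0 s0 by (simp add: s_def flip: powr_mult)
    finally have "ennreal (i powr p) \<le> ennreal (W powr (p - 1)) * E x"
      using e by (simp flip: ennreal_mult)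
    with int show ?case by (simp add: i_def)
  qed
  show "AE x in M1. integrable M2 (u x)" using key by eventually_elim auto
  have "(\<integral>\<^sup>+x. ennreal ((LINT t|M2. \<bar>u x t\<bar>) powr p) \<partial>M1)
          \<le> (\<integral>\<^sup>+x. ennreal (W powr (p - 1)) * E x \<partial>M1)"
    using key by (intro nn_integral_mono_AE) auto
  also have "\<dots> = ennreal (W powr (p - 1)) * (\<integral>\<^sup>+x. E x \<partial>M1)"
    by (intro nn_integral_cmult) measurable
  also have "\<dots> \<le> ennreal (W powr (p - 1)) * ennreal W"
    by (intro mult_left_mono EW) auto
  also have "\<dots> = ennreal (W powr p)"
    using W powr_mult_base[of W "p - 1"] by (simp add: mult.commute flip: ennreal_mult)
  finally show "(\<integral>\<^sup>+x. ennreal ((LINT t|M2. \<bar>u x t\<bar>) powr p) \<partial>M1) \<le> ennreal (W powr p)" .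
qed

text \<open>
  The case of the essential supremum. The exceptional null set may depend on \<open>t\<close>, and exchanging the
  two almost-everywhere quantifiers removes this dependence.
\<close>

lemma (in pair_sigma_finite) Minkowski_integral_inequality_esssup:
  fixes u :: "'a \<Rightarrow> 'b \<Rightarrow> real" and V :: "'b \<Rightarrow> real" and W :: real
  assumes u [measurable]: "case_prod u \<in> borel_measurable (M1 \<Otimes>\<^sub>M M2)"
    and V [measurable]: "V \<in> borel_measurable M2"
    and uV: "\<And>t. t \<in> space M2 \<Longrightarrow> AE x in M1. \<bar>u x t\<bar> \<le> V t"
    and W: "0 \<le> W" "(\<integral>\<^sup>+t. ennreal (V t) \<partial>M2) \<le> ennreal W"
  shows "AE x in M1. integrable M2 (u x) \<and> (LINT t|M2. \<bar>u x t\<bar>) \<le> W"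
proof -
  have "AE t in M2. AE x in M1. \<bar>u x t\<bar> \<le> V t" using uV by (rule AE_I2)
  hence "AE x in M1. AE t in M2. \<bar>u x t\<bar> \<le> V t" by (subst AE_commute) auto
  moreover have "AE x in M1. x \<in> space M1" by (rule AE_space)
  ultimately show ?thesis
  proof eventually_elim
    case (elim x)
    have [measurable]: "u x \<in> borel_measurable M2" using elim(2) by measurable
    have "(\<integral>\<^sup>+t. ennreal \<bar>u x t\<bar> \<partial>M2) \<le> (\<integral>\<^sup>+t. ennreal (V t) \<partial>M2)"
      using elim(1) by (intro nn_integral_mono_AE) (auto intro: ennreal_leI)
    also note W(2)
    finally have le: "(\<integral>\<^sup>+t. ennreal \<bar>u x t\<bar> \<partial>M2) \<le> ennreal W" .
    have int: "integrable M2 (u x)"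
      using le by (intro integrableI_bounded) (auto simp: less_top[symmetric] top_unique)
    have "(\<integral>\<^sup>+t. ennreal \<bar>u x t\<bar> \<partial>M2) = ennreal (LINT t|M2. \<bar>u x t\<bar>)"
      using int by (intro nn_integral_eq_integral) auto
    with le W show ?case using int by (simp add: ennreal_le_iff)
  qed
qed

section \<open>Integrals of periodic functions\<close>

lemma periodic_int_mult:
  fixes h :: "real \<Rightarrow> 'a" and m :: int
  assumes "\<And>x. h (x + 2 * pi) = h x"
  shows "h (x + of_int m * (2 * pi)) = h x"
proof -
  have nat: "h (x + of_nat n * (2 * pi)) = h x" for n :: nat and x
  proof (induction n)
    case (Suc n)
    have "h (x + of_nat (Suc n) * (2 * pi)) = h ((x + of_nat n * (2 * pi)) + 2 * pi)"
      by (simp add: algebra_simps)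
    with Suc assms show ?case by simp
  qed simp
  show ?thesis
  proof (cases "0 \<le> m")
    case True
    thus ?thesis using nat[of x "nat m"] by simp
  next
    case False
    thus ?thesis using nat[of "x + of_int m * (2 * pi)" "nat (- m)"] by simp
  qed
qed

lemma obtain_period_shift:
  fixes x :: real
  obtains m :: int where "0 \<le> x - of_int m * (2 * pi)" "x - of_int m * (2 * pi) < 2 * pi"
proof
  let ?m = "\<lfloor>x / (2 * pi)\<rfloor>"
  have "of_int ?m \<le> x / (2 * pi)" "x / (2 * pi) < of_int ?m + 1" by linarith+
  hence "of_int ?m * (2 * pi) \<le> x / (2 * pi) * (2 * pi)" 
      "x / (2 * pi) * (2 * pi) < (of_int ?m + 1) * (2 * pi)"
    by (intro mult_right_mono mult_strict_right_mono; simp)+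
  thus "0 \<le> x - of_int ?m * (2 * pi)" "x - of_int ?m * (2 * pi) < 2 * pi"
    by (simp_all add: algebra_simps)
qed

text \<open>
  After reduction of \<open>a\<close> modulo the period to \<open>b \<in> [0, 2\<pi>)\<close>, the part \<open>[\<pi>, b + \<pi>)\<close> of the shifted
  interval is moved back by one period and fills the gap \<open>[-\<pi>, b - \<pi>)\<close>.
\<close>

lemma nn_integral_period_shift:
  fixes h :: "real \<Rightarrow> ennreal"
  assumes [measurable]: "h \<in> borel_measurable borel" and per: "\<And>x. h (x + 2 * pi) = h x"
  shows "(\<integral>\<^sup>+x. h (x + a) * indicator {-pi..pi} x \<partial>lborel)
       = (\<integral>\<^sup>+x. h x * indicator {-pi..pi} x \<partial>lborel)"
proof -
  obtain m :: int where m: "0 \<le> a - of_int m * (2 * pi)" "a - of_int m * (2 * pi) < 2 * pi"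
    by (rule obtain_period_shift)
  define b where "b = a - of_int m * (2 * pi)"
  have b: "0 \<le> b" "b < 2 * pi" using m by (auto simp: b_def)
  \<comment> \<open>half-open intervals decompose without overlaps\<close>
  have halfopen: "(\<integral>\<^sup>+x. h (x + c) * indicator {-pi..pi} x \<partial>lborel)
             = (\<integral>\<^sup>+x. h (x + c) * indicator {-pi..<pi} x \<partial>lborel)" for c
  proof (rule nn_integral_cong_AE)
    have "AE x in lborel. x \<noteq> pi" by (rule AE_lborel_singleton)
    thus "AE x in lborel. h (x + c) * indicator {-pi..pi} x = h (x + c) * indicator {-pi..<pi} x"
      by eventually_elim (auto split: split_indicator)
  qed
  have "h (x + a) = h (x + b)" for x
    using periodic_int_mult[of h "x + b" m, OF per] by (simp add: b_def)
  hence "(\<integral>\<^sup>+x. h (x + a) * indicator {-pi..pi} x \<partial>lborel)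
       = (\<integral>\<^sup>+x. h (x + b) * indicator {-pi..<pi} x \<partial>lborel)"
    using halfopen[of b] by simp
  also have "\<dots> = (\<integral>\<^sup>+x. h x * indicator {b-pi..<b+pi} x \<partial>lborel)"
    by (subst nn_integral_real_affine[where c=1 and t="b" and f="\<lambda>x. h x * indicator {b-pi..<b+pi} x"])
       (auto intro!: nn_integral_cong simp: add.commute split: split_indicator)
  also have "\<dots> = (\<integral>\<^sup>+x. h x * indicator {b-pi..<pi} x + h x * indicator {pi..<b+pi} x \<partial>lborel)"
    using b by (intro nn_integral_cong) (auto split: split_indicator)
  also have "\<dots> = (\<integral>\<^sup>+x. h x * indicator {b-pi..<pi} x \<partial>lborel)
                 + (\<integral>\<^sup>+x. h x * indicator {pi..<b+pi} x \<partial>lborel)"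
    by (intro nn_integral_add) measurable
  also have "(\<integral>\<^sup>+x. h x * indicator {pi..<b+pi} x \<partial>lborel)
           = (\<integral>\<^sup>+x. h x * indicator {-pi..<b-pi} x \<partial>lborel)"
    using per
    by (subst nn_integral_real_affine[where c=1 and t="2*pi"])
       (auto intro!: nn_integral_cong simp: add.commute split: split_indicator)
  also have "(\<integral>\<^sup>+x. h x * indicator {b-pi..<pi} x \<partial>lborel) + \<dots>
       = (\<integral>\<^sup>+x. h x * indicator {b-pi..<pi} x + h x * indicator {-pi..<b-pi} x \<partial>lborel)"
    by (intro nn_integral_add[symmetric]) measurable
  also have "\<dots> = (\<integral>\<^sup>+x. h x * indicator {-pi..<pi} x \<partial>lborel)"
    using b by (intro nn_integral_cong) (auto split: split_indicator)
  also have "\<dots> = (\<integral>\<^sup>+x. h x * indicator {-pi..pi} x \<partial>lborel)"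
    using halfopen[of 0] by simp
  finally show ?thesis .
qed

lemma set_integral_period_shift:
  fixes h :: "real \<Rightarrow> real"
  assumes per: "\<And>x. h (x + 2 * pi) = h x" and [measurable]: "h \<in> borel_measurable borel"
    and int: "set_integrable lborel {-pi..pi} h"
  shows "set_integrable lborel {-pi..pi} (\<lambda>x. h (x + a))"
    and "(LINT x:{-pi..pi}|lborel. h (x + a)) = (LINT x:{-pi..pi}|lborel. h x)"
proof -
  have shift: "(\<integral>\<^sup>+x. ennreal (k (h (x + a))) * indicator {-pi..pi} x \<partial>lborel)
             = (\<integral>\<^sup>+x. ennreal (k (h x)) * indicator {-pi..pi} x \<partial>lborel)"
    if [measurable]: "k \<in> borel_measurable borel" for k :: "real \<Rightarrow> real"
    by (rule nn_integral_period_shift[where h="\<lambda>x. ennreal (k (h x))"]) (auto simp: per)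
  have ind: "ennreal (c * (indicator {-pi..pi} x *\<^sub>R z)) = ennreal (c * z) * indicator {-pi..pi} x"
    for c x z :: real by (auto split: split_indicator)
  have ind_abs: "ennreal (norm (indicator {-pi..pi} x *\<^sub>R z)) = ennreal \<bar>z\<bar> * indicator {-pi..pi} x"
    for x z :: real by (auto split: split_indicator)
  show int': "set_integrable lborel {-pi..pi} (\<lambda>x. h (x + a))"
    using int shift[of abs] unfolding set_integrable_def integrable_iff_bounded ind_abs
    by simp
  show "(LINT x:{-pi..pi}|lborel. h (x + a)) = (LINT x:{-pi..pi}|lborel. h x)"
    unfolding set_lebesgue_integral_def
      real_lebesgue_integral_def[OF int[unfolded set_integrable_def]]
      real_lebesgue_integral_def[OF int'[unfolded set_integrable_def]]
    using shift[of "\<lambda>x. 1 * x"] shift[of "\<lambda>x. - 1 * x"] ind[of 1] ind[of "-1"] by simp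
qed

lemma set_integral_symmetric_interval:
  fixes q :: "real \<Rightarrow> real"
  assumes int: "set_integrable lborel {-c..c} q"
  shows "set_integrable lborel {0<..c} q" "set_integrable lborel {0<..c} (\<lambda>s. q (- s))"
    and "(LINT s:{-c..c}|lborel. q s) = (LINT s:{0<..c}|lborel. q s + q (- s))"
proof -
  show pos: "set_integrable lborel {0<..c} q"
    by (rule set_integrable_subset[OF int]) auto
  have neg: "set_integrable lborel {-c..<0} q"
    by (rule set_integrable_subset[OF int]) auto
  have ind: "indicator {-c..<0} (0 + (-1) * s) = (indicator {0<..c} s :: real)" for s
    by (auto split: split_indicator)
  show neg': "set_integrable lborel {0<..c} (\<lambda>s. q (- s))"
    using lborel_integrable_real_affine[OF neg[unfolded set_integrable_def], of "-1" 0]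
    unfolding set_integrable_def ind by simp
  have "(LINT s:{-c..<0}|lborel. q s) = (LINT s:{0<..c}|lborel. q (- s))"
    unfolding set_lebesgue_integral_def
    by (subst lborel_integral_real_affine[where c="-1" and t=0]) (simp_all only: ind, simp_all)
  moreover have "(LINT s:{-c..c}|lborel. q s) = (LINT s:{-c..<0} \<union> {0<..c}|lborel. q s)"
    unfolding set_lebesgue_integral_def
  proof (rule integral_cong_AE)
    have "AE s in lborel. s \<noteq> (0::real)" by (rule AE_lborel_singleton)
    thus "AE s in lborel. indicator {-c..c} s *\<^sub>R q s = indicator ({-c..<0} \<union> {0<..c}) s *\<^sub>R q s"
      by eventually_elim (auto split: split_indicator)
    show "(\<lambda>s. indicator ({-c..<0} \<union> {0<..c}) s *\<^sub>R q s) \<in> borel_measurable lborel"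
      by (rule borel_measurable_integrable, fold set_integrable_def)
         (rule set_integrable_subset[OF int]; auto)
    show "(\<lambda>s. indicator {-c..c} s *\<^sub>R q s) \<in> borel_measurable lborel"
      using int unfolding set_integrable_def by (rule borel_measurable_integrable)
  qed
  moreover have "\<dots> = (LINT s:{-c..<0}|lborel. q s) + (LINT s:{0<..c}|lborel. q s)"
    by (rule set_integral_Un[OF _ neg pos]) auto
  moreover have "(LINT s:{0<..c}|lborel. q s + q (- s))
      = (LINT s:{0<..c}|lborel. q s) + (LINT s:{0<..c}|lborel. q (- s))"
    by (rule set_integral_add[OF pos neg'])
  ultimately show "(LINT s:{-c..c}|lborel. q s) = (LINT s:{0<..c}|lborel. q s + q (- s))"
    by simp
qed

text \<open>
  The line is the union of countably many translates of one period, so a periodic property needs to be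
  checked almost everywhere on one period only.
\<close>

lemma AE_periodic:
  assumes [measurable]: "Measurable.pred borel P" and per: "\<And>x. P (x + 2 * pi) = P x"
    and AE: "AE x in lborel. x \<in> {-pi..pi} \<longrightarrow> P x"
  shows "AE x in lborel. P (x :: real)"
proof -
  have "AE x in lborel. of_int m * (2 * pi) + 1 * x \<in> {-pi..pi} \<longrightarrow> P (of_int m * (2 * pi) + 1 * x)"
    for m :: int
    using AE_borel_affine[OF _ _ AE, of 1 "of_int m * (2 * pi)"] by simp
  hence "AE x in lborel. \<forall>m::int. of_int m * (2 * pi) + 1 * x \<in> {-pi..pi}
           \<longrightarrow> P (of_int m * (2 * pi) + 1 * x)"
    by (subst AE_all_countable) auto
  thus ?thesis
  proof eventually_elim
    case (elim x)
    obtain m :: int where m: "0 \<le> (x + pi) - of_int m * (2 * pi)"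
        "(x + pi) - of_int m * (2 * pi) < 2 * pi"
      by (rule obtain_period_shift)
    have "P (x + of_int (- m) * (2 * pi))"
      using elim[rule_format, of "- m"] m by (simp add: algebra_simps)
    thus ?case using periodic_int_mult[of P x "- m", OF per] by simp
  qed
qed

lemma integrable_bounded_factor:
  fixes g q :: "real \<Rightarrow> real"
  assumes "set_integrable lborel S g" "S \<in> sets borel" "q \<in> borel_measurable borel" "\<And>x. \<bar>q x\<bar> \<le> B"
  shows "set_integrable lborel S (\<lambda>x. g x * q x)"
proof -
  note [measurable] = assms(2,3)
  have "integrable lborel (\<lambda>x. (indicator S x *\<^sub>R g x) * q x)"
  proof (rule Bochner_Integration.integrable_bound)
    show "integrable lborel (\<lambda>x. B * (indicator S x *\<^sub>R g x))"
      using assms(1) unfolding set_integrable_def by (rule integrable_mult_right)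
    show "(\<lambda>x. (indicator S x *\<^sub>R g x) * q x) \<in> borel_measurable lborel"
      using borel_measurable_integrable[OF assms(1)[unfolded set_integrable_def]] by measurable
    have "\<bar>q x\<bar> \<le> \<bar>B\<bar>" for x using assms(4)[of x] by linarith
    thus "AE x in lborel. norm (indicator S x *\<^sub>R g x * q x) \<le> norm (B * (indicator S x *\<^sub>R g x))"
      by (intro AE_I2) (auto simp: abs_mult mult.commute[of "\<bar>B\<bar>"] intro!: mult_left_mono split: split_indicator)
  qed
  thus ?thesis by (simp add: set_integrable_def mult_ac)
qed

text \<open>
  Each term of the conjugate Fourier sum is a convolution of \<open>g\<close> with a sine. Shifting the period to be
  centred at \<open>x\<close> and folding it at its centre turns \<open>g\<close> into the difference \<open>psi g x\<close>, because the
  sine is odd.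
\<close>

lemma conj_partial_sum_eq_integral:
  assumes per: "periodic_2pi g" and [measurable]: "g \<in> borel_measurable borel"
    and int: "set_integrable lborel {-pi..pi} g"
  shows "conj_partial_sum k g x
       = - (1 / pi) * (LINT t:{0<..pi}|lborel. psi g x t * (\<Sum>\<nu>=1..k. sin (real \<nu> * t)))"
proof -
  have g: "g (x + 2 * pi) = g x" for x using per by (simp add: periodic_2pi_def)
  have leb: "(LINT t:{-pi..pi}|lebesgue. g t * q t) = (LINT t:{-pi..pi}|lborel. g t * q t)"
    if [measurable]: "q \<in> borel_measurable borel" for q :: "real \<Rightarrow> real"
    unfolding set_lebesgue_integral_def by (intro integral_completion) measurable
  have shift: "set_integrable lborel {-pi..pi} (\<lambda>t. g (t + x))"
    by (rule set_integral_period_shift(1)[OF g _ int]) measurable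
  have summand: "fourier_a g \<nu> * sin (real \<nu> * x) - fourier_b g \<nu> * cos (real \<nu> * x)
      = - (1 / pi) * (LINT t:{0<..pi}|lborel. psi g x t * sin (real \<nu> * t))
      \<and> set_integrable lborel {0<..pi} (\<lambda>t. psi g x t * sin (real \<nu> * t))" for \<nu>
  proof -
    have ic: "set_integrable lborel {-pi..pi} (\<lambda>t. g t * cos (real \<nu> * t))"
      by (rule integrable_bounded_factor[OF int, where B=1]) auto
    have isin: "set_integrable lborel {-pi..pi} (\<lambda>t. g t * sin (real \<nu> * t))"
      by (rule integrable_bounded_factor[OF int, where B=1]) auto
    define h where "h t = g t * sin (real \<nu> * (x - t))" for t
    have h_int: "set_integrable lborel {-pi..pi} h"
      unfolding h_def by (rule integrable_bounded_factor[OF int, where B=1]) auto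
    have h_per: "h (t + 2 * pi) = h t" for t
    proof -
      have "sin (real \<nu> * (x - (t + 2 * pi))) = sin (real \<nu> * (x - t) - real \<nu> * (2 * pi))"
        by (simp add: algebra_simps)
      also have "\<dots> = sin (real \<nu> * (x - t))"
        using sin_int_2pin[of "int \<nu>"] cos_int_2pin[of "int \<nu>"]
        by (simp add: sin_diff mult_ac)
      finally show ?thesis by (simp add: h_def g)
    qed
    have [measurable]: "h \<in> borel_measurable borel" unfolding h_def by measurable
    have eq: "h (t + x) + h (- t + x) = - (psi g x t * sin (real \<nu> * t))" for t
      by (simp add: h_def psi_def algebra_simps)
    have "fourier_a g \<nu> * sin (real \<nu> * x) - fourier_b g \<nu> * cos (real \<nu> * x)
       = (1 / pi) * ((LINT t:{-pi..pi}|lborel. sin (real \<nu> * x) * (g t * cos (real \<nu> * t)))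
                    - (LINT t:{-pi..pi}|lborel. cos (real \<nu> * x) * (g t * sin (real \<nu> * t))))"
      by (simp add: fourier_a_def fourier_b_def leb right_diff_distrib
            mult.commute[of _ "sin (real \<nu> * x)"] mult.commute[of _ "cos (real \<nu> * x)"])
    also have "\<dots> = (1 / pi) * (LINT t:{-pi..pi}|lborel.
        sin (real \<nu> * x) * (g t * cos (real \<nu> * t)) - cos (real \<nu> * x) * (g t * sin (real \<nu> * t)))"
      using ic isin by (subst set_integral_diff) auto
    also have "(LINT t:{-pi..pi}|lborel.
        sin (real \<nu> * x) * (g t * cos (real \<nu> * t)) - cos (real \<nu> * x) * (g t * sin (real \<nu> * t)))
        = (LINT t:{-pi..pi}|lborel. h t)"
      by (intro arg_cong[where f="set_lebesgue_integral lborel {-pi..pi}"])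
         (simp add: h_def fun_eq_iff right_diff_distrib sin_diff algebra_simps)
    also have "\<dots> = (LINT t:{-pi..pi}|lborel. h (t + x))"
      by (rule set_integral_period_shift(2)[OF h_per _ h_int, symmetric]) measurable
    also have "\<dots> = (LINT t:{0<..pi}|lborel. h (t + x) + h (- t + x))"
      by (rule set_integral_symmetric_interval(3)[OF set_integral_period_shift(1)[OF h_per _ h_int]])
         measurable
    also have "\<dots> = - (LINT t:{0<..pi}|lborel. psi g x t * sin (real \<nu> * t))"
      unfolding eq by (simp add: set_lebesgue_integral_def)
    finally have "fourier_a g \<nu> * sin (real \<nu> * x) - fourier_b g \<nu> * cos (real \<nu> * x)
      = - (1 / pi) * (LINT t:{0<..pi}|lborel. psi g x t * sin (real \<nu> * t))"
      by simp
    moreover have "set_integrable lborel {-pi..pi} (\<lambda>t. h (t + x))"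
      by (rule set_integral_period_shift(1)[OF h_per _ h_int]) measurable
    note set_integral_add(1)[OF set_integral_symmetric_interval(1,2)[OF this]]
    hence "set_integrable lborel {0<..pi} (\<lambda>t. psi g x t * sin (real \<nu> * t))"
      unfolding eq by (simp add: set_integrable_def)
    ultimately show ?thesis by blast
  qed
  have "conj_partial_sum k g x
      = (\<Sum>\<nu>=1..k. - (1 / pi) * (LINT t:{0<..pi}|lborel. psi g x t * sin (real \<nu> * t)))"
    unfolding conj_partial_sum_def using summand by (intro sum.cong) auto
  also have "\<dots> = - (1 / pi) * (\<Sum>\<nu>=1..k. (LINT t:{0<..pi}|lborel. psi g x t * sin (real \<nu> * t)))"
    by (simp add: sum_distrib_left)
  also have "(\<Sum>\<nu>=1..k. (LINT t:{0<..pi}|lborel. psi g x t * sin (real \<nu> * t)))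
       = (LINT t:{0<..pi}|lborel. (\<Sum>\<nu>=1..k. psi g x t * sin (real \<nu> * t)))"
    using summand unfolding set_lebesgue_integral_def set_integrable_def
    by (subst Bochner_Integration.integral_sum[symmetric]) (auto simp: scaleR_sum_right sum_distrib_left)
  finally show ?thesis by (simp add: sum_distrib_left)
qed

section \<open>Integral operators acting on symmetric differences\<close>

lemma borel_measurable_psi [measurable]:
  assumes [measurable]: "g \<in> borel_measurable borel" "q \<in> borel_measurable M" "s \<in> borel_measurable M"
  shows "(\<lambda>z. psi g (q z) (s z)) \<in> borel_measurable M"
  unfolding psi_def by measurable

lemma psi_periodic: "periodic_2pi g \<Longrightarrow> psi g (x + 2 * pi) t = psi g x t"
proof -
  assume "periodic_2pi g"
  hence "g ((x + t) + 2 * pi) = g (x + t)" "g ((x - t) + 2 * pi) = g (x - t)"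
    unfolding periodic_2pi_def by blast+
  thus ?thesis by (simp add: psi_def algebra_simps)
qed

text \<open>
  Minkowski's inequality is applied to \<open>psi g x t * k t\<close> cut off to one period in \<open>x\<close> and to \<open>(0, \<pi>]\<close>
  in \<open>t\<close>; integrability then extends from the period to the line.
\<close>

lemma kernel_operator_Lp:
  fixes g k v :: "real \<Rightarrow> real" and p W :: real
  assumes per: "periodic_2pi g" and [measurable]: "g \<in> borel_measurable borel"
      "k \<in> borel_measurable borel" "v \<in> borel_measurable borel"
    and p: "1 \<le> p" and v0: "\<And>t. 0 \<le> v t"
    and psi: "\<And>t. t \<in> {0<..pi} \<Longrightarrow>
        (\<integral>\<^sup>+x. ennreal (\<bar>psi g x t\<bar> powr p) * indicator {-pi..pi} x \<partial>lborel) \<le> ennreal (v t powr p)"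
    and W: "0 < W" "(\<integral>\<^sup>+t. ennreal (v t * \<bar>k t\<bar>) * indicator {0<..pi} t \<partial>lborel) \<le> ennreal W"
  shows "AE x in lborel. set_integrable lborel {0<..pi} (\<lambda>t. psi g x t * k t)"
    and "(\<integral>\<^sup>+x. ennreal (\<bar>LINT t:{0<..pi}|lborel. psi g x t * k t\<bar> powr p) * indicator {-pi..pi} x \<partial>lborel)
           \<le> ennreal (W powr p)"
proof -
  define u where "u x t = indicator {-pi..pi} x * (indicator {0<..pi} t * (psi g x t * k t))" for x t
  define V where "V t = indicator {0<..pi} t * (v t * \<bar>k t\<bar>)" for t
  have u: "case_prod u \<in> borel_measurable (lborel \<Otimes>\<^sub>M lborel)"
    unfolding u_def by measurable
  have V: "V \<in> borel_measurable lborel" unfolding V_def by measurable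
  have V0: "0 \<le> V t" for t by (simp add: V_def v0)
  have uV: "(\<integral>\<^sup>+x. ennreal (\<bar>u x t\<bar> powr p) \<partial>lborel) \<le> ennreal (V t powr p)" for t
  proof (cases "t \<in> {0<..pi}")
    case True
    have "ennreal (\<bar>u x t\<bar> powr p)
        = ennreal (\<bar>k t\<bar> powr p) * (ennreal (\<bar>psi g x t\<bar> powr p) * indicator {-pi..pi} x)" for x
      using True by (auto simp: u_def abs_mult powr_mult mult.commute ennreal_mult split: split_indicator)
    hence "(\<integral>\<^sup>+x. ennreal (\<bar>u x t\<bar> powr p) \<partial>lborel) = ennreal (\<bar>k t\<bar> powr p) *
             (\<integral>\<^sup>+x. ennreal (\<bar>psi g x t\<bar> powr p) * indicator {-pi..pi} x \<partial>lborel)"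
      by (simp add: nn_integral_cmult)
    also have "\<dots> \<le> ennreal (\<bar>k t\<bar> powr p) * ennreal (v t powr p)"
      by (intro mult_left_mono psi True) auto
    also have "\<dots> = ennreal (V t powr p)"
      using True v0 by (simp add: V_def powr_mult mult.commute flip: ennreal_mult)
    finally show ?thesis .
  qed (simp add: u_def)
  have VW: "(\<integral>\<^sup>+t. ennreal (V t) \<partial>lborel) \<le> ennreal W"
  proof -
    have "ennreal (V t) = ennreal (v t * \<bar>k t\<bar>) * indicator {0<..pi} t" for t
      by (simp add: V_def split: split_indicator)
    thus ?thesis using W(2) by simp
  qed
  note Mink = lborel_pair.Minkowski_integral_inequality[OF u V p V0 uV W(1) VW]
  show "AE x in lborel. set_integrable lborel {0<..pi} (\<lambda>t. psi g x t * k t)"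
  proof (rule AE_periodic)
    show "Measurable.pred borel (\<lambda>x. set_integrable lborel {0<..pi} (\<lambda>t. psi g x t * k t))"
      unfolding set_integrable_def by measurable
    show "set_integrable lborel {0<..pi} (\<lambda>t. psi g (x + 2 * pi) t * k t)
        = set_integrable lborel {0<..pi} (\<lambda>t. psi g x t * k t)" for x
      by (simp add: psi_periodic[OF per])
    show "AE x in lborel. x \<in> {-pi..pi} \<longrightarrow> set_integrable lborel {0<..pi} (\<lambda>t. psi g x t * k t)"
      using Mink(1) by eventually_elim (auto simp: u_def set_integrable_def)
  qed
  have "(\<integral>\<^sup>+x. ennreal (\<bar>LINT t:{0<..pi}|lborel. psi g x t * k t\<bar> powr p) * indicator {-pi..pi} x \<partial>lborel)
      \<le> (\<integral>\<^sup>+x. ennreal ((LINT t|lborel. \<bar>u x t\<bar>) powr p) \<partial>lborel)"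
  proof (rule nn_integral_mono)
    fix x :: real
    show "ennreal (\<bar>LINT t:{0<..pi}|lborel. psi g x t * k t\<bar> powr p) * indicator {-pi..pi} x
        \<le> ennreal ((LINT t|lborel. \<bar>u x t\<bar>) powr p)"
    proof (cases "x \<in> {-pi..pi}")
      case True
      have "\<bar>LINT t:{0<..pi}|lborel. psi g x t * k t\<bar> \<le> (LINT t|lborel. \<bar>u x t\<bar>)"
        using True integral_norm_bound[of lborel "u x"]
        by (simp add: set_lebesgue_integral_def u_def)
      thus ?thesis using True p by (auto intro!: ennreal_leI powr_mono2)
    qed simp
  qed
  also note Mink(2)
  finally show "(\<integral>\<^sup>+x. ennreal (\<bar>LINT t:{0<..pi}|lborel. psi g x t * k t\<bar> powr p) * indicator {-pi..pi} x \<partial>lborel)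
           \<le> ennreal (W powr p)" .
qed

lemma kernel_operator_Linf:
  fixes g k v :: "real \<Rightarrow> real" and W :: real
  assumes per: "periodic_2pi g" and [measurable]: "g \<in> borel_measurable borel"
      "k \<in> borel_measurable borel" "v \<in> borel_measurable borel"
    and psi: "\<And>t. t \<in> {0<..pi} \<Longrightarrow> AE x in lborel. x \<in> {-pi..pi} \<longrightarrow> \<bar>psi g x t\<bar> \<le> v t"
    and W: "0 \<le> W" "(\<integral>\<^sup>+t. ennreal (v t * \<bar>k t\<bar>) * indicator {0<..pi} t \<partial>lborel) \<le> ennreal W"
  shows "AE x in lborel. set_integrable lborel {0<..pi} (\<lambda>t. psi g x t * k t)
                       \<and> \<bar>LINT t:{0<..pi}|lborel. psi g x t * k t\<bar> \<le> W"
proof -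
  define u where "u x t = indicator {-pi..pi} x * (indicator {0<..pi} t * (psi g x t * k t))" for x t
  define V where "V t = indicator {0<..pi} t * (v t * \<bar>k t\<bar>)" for t
  have u: "case_prod u \<in> borel_measurable (lborel \<Otimes>\<^sub>M lborel)"
    unfolding u_def by measurable
  have V: "V \<in> borel_measurable lborel" unfolding V_def by measurable
  have uV: "AE x in lborel. \<bar>u x t\<bar> \<le> V t" for t
  proof (cases "t \<in> {0<..pi}")
    case True
    show ?thesis using psi[OF True]
    proof eventually_elim
      case (elim x)
      show ?case
      proof (cases "x \<in> {-pi..pi}")
        case False
        \<comment> \<open>outside the period the cut-off function is \<open>0\<close>, and \<open>v t\<close> bounds an absolute value on a set of
            positive measure\<close>
        have "0 \<le> v t"
        proof (rule ccontr)
          assume "\<not> 0 \<le> v t"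
          hence "\<not> \<bar>psi g x t\<bar> \<le> v t" for x by linarith
          hence "AE x in lborel. x \<notin> {-pi..pi}" using psi[OF True] by auto
          hence "emeasure lborel {-pi..pi} = 0"
            by (subst (asm) AE_iff_measurable[where N="{-pi..pi}"]) auto
          thus False by simp
        qed
        with False show ?thesis by (simp add: u_def V_def)
      qed (use elim True in \<open>auto simp: u_def V_def abs_mult intro!: mult_right_mono\<close>)
    qed
  qed (simp add: u_def V_def)
  have VW: "(\<integral>\<^sup>+t. ennreal (V t) \<partial>lborel) \<le> ennreal W"
  proof -
    have "ennreal (V t) = ennreal (v t * \<bar>k t\<bar>) * indicator {0<..pi} t" for t
      by (simp add: V_def split: split_indicator)
    thus ?thesis using W(2) by simp
  qed
  note Mink = lborel_pair.Minkowski_integral_inequality_esssup[OF u V uV W(1) VW]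
  show ?thesis
  proof (rule AE_periodic)
    show "Measurable.pred borel (\<lambda>x. set_integrable lborel {0<..pi} (\<lambda>t. psi g x t * k t)
                       \<and> \<bar>LINT t:{0<..pi}|lborel. psi g x t * k t\<bar> \<le> W)"
      unfolding set_integrable_def set_lebesgue_integral_def by measurable
    show "(set_integrable lborel {0<..pi} (\<lambda>t. psi g (x + 2 * pi) t * k t)
            \<and> \<bar>LINT t:{0<..pi}|lborel. psi g (x + 2 * pi) t * k t\<bar> \<le> W)
        = (set_integrable lborel {0<..pi} (\<lambda>t. psi g x t * k t)
            \<and> \<bar>LINT t:{0<..pi}|lborel. psi g x t * k t\<bar> \<le> W)" for x
      by (simp add: psi_periodic[OF per])
    show "AE x in lborel. x \<in> {-pi..pi} \<longrightarrow>
       set_integrable lborel {0<..pi} (\<lambda>t. psi g x t * k t)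
            \<and> \<bar>LINT t:{0<..pi}|lborel. psi g x t * k t\<bar> \<le> W"
      using Mink
    proof eventually_elim
      case (elim x)
      show ?case
      proof
        assume x: "x \<in> {-pi..pi}"
        hence ux: "u x = (\<lambda>t. indicator {0<..pi} t * (psi g x t * k t))"
          by (auto simp: u_def)
        show "set_integrable lborel {0<..pi} (\<lambda>t. psi g x t * k t)
            \<and> \<bar>LINT t:{0<..pi}|lborel. psi g x t * k t\<bar> \<le> W"
          using elim order_trans[OF integral_norm_bound[of lborel "u x"], of W] unfolding ux
          by (simp add: set_lebesgue_integral_def set_integrable_def)
      qed
    qed
  qed
qed

text \<open>
  All bounds are uniform in \<open>x\<close>, so \<open>v t * \<bar>k t\<bar>\<close> is one dominating function for all \<open>x\<close>; this
  gives the continuity of the integral as well.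
\<close>

lemma kernel_operator_Cont:
  fixes g k v :: "real \<Rightarrow> real" and W :: real
  assumes g: "continuous_on UNIV g"
    and [measurable]: "k \<in> borel_measurable borel" "v \<in> borel_measurable borel"
    and psi: "\<And>x t. t \<in> {0<..pi} \<Longrightarrow> \<bar>psi g x t\<bar> \<le> v t"
    and W: "0 \<le> W" "(\<integral>\<^sup>+t. ennreal (v t * \<bar>k t\<bar>) * indicator {0<..pi} t \<partial>lborel) \<le> ennreal W"
  shows "set_integrable lborel {0<..pi} (\<lambda>t. psi g x t * k t)"
    and "\<bar>LINT t:{0<..pi}|lborel. psi g x t * k t\<bar> \<le> W"
    and "continuous_on UNIV (\<lambda>x. LINT t:{0<..pi}|lborel. psi g x t * k t)"
proof -
  have [measurable]: "g \<in> borel_measurable borel"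
    using g by (rule borel_measurable_continuous_onI)
  have dom: "norm (indicator {0<..pi} t *\<^sub>R (psi g x t * k t)) \<le> indicator {0<..pi} t *\<^sub>R (v t * \<bar>k t\<bar>)"
    for x t using psi[of t x] by (auto simp: abs_mult mult_right_mono split: split_indicator)
  have eq: "ennreal (norm (indicator {0<..pi} t *\<^sub>R (v t * \<bar>k t\<bar>)))
      = ennreal (v t * \<bar>k t\<bar>) * indicator {0<..pi} t" for t
    using order_trans[OF abs_ge_zero psi[of t 0]] by (auto split: split_indicator simp: abs_mult)
  have int: "integrable lborel (\<lambda>t. indicator {0<..pi} t *\<^sub>R (v t * \<bar>k t\<bar>))"
    using le_less_trans[OF W(2) ennreal_less_top]
    by (intro integrableI_bounded, measurable) (simp only: eq, simp)
  show i: "set_integrable lborel {0<..pi} (\<lambda>t. psi g x t * k t)" for x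
    unfolding set_integrable_def
    by (rule Bochner_Integration.integrable_bound[OF int], measurable)
       (intro AE_I2 order_trans[OF dom] norm_ge_zero, auto)
  have "\<bar>LINT t:{0<..pi}|lborel. psi g x t * k t\<bar>
          \<le> (LINT t|lborel. norm (indicator {0<..pi} t *\<^sub>R (psi g x t * k t)))"
    unfolding set_lebesgue_integral_def using integral_norm_bound[of lborel] by simp
  also have "\<dots> \<le> (LINT t|lborel. indicator {0<..pi} t *\<^sub>R (v t * \<bar>k t\<bar>))"
    using i dom int unfolding set_integrable_def by (intro integral_mono integrable_norm) auto
  also have "\<dots> \<le> W"
  proof -
    have "ennreal (LINT t|lborel. indicator {0<..pi} t *\<^sub>R (v t * \<bar>k t\<bar>))
        = (\<integral>\<^sup>+t. ennreal (indicator {0<..pi} t *\<^sub>R (v t * \<bar>k t\<bar>)) \<partial>lborel)"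
      by (intro nn_integral_eq_integral[symmetric] int AE_I2 order_trans[OF norm_ge_zero dom])
    also have "\<dots> = (\<integral>\<^sup>+t. ennreal (v t * \<bar>k t\<bar>) * indicator {0<..pi} t \<partial>lborel)"
      by (intro nn_integral_cong) (auto split: split_indicator)
    also note W(2)
    finally show ?thesis using W(1) by (simp add: ennreal_le_iff)
  qed
  finally show "\<bar>LINT t:{0<..pi}|lborel. psi g x t * k t\<bar> \<le> W" .
  show "continuous_on UNIV (\<lambda>x. LINT t:{0<..pi}|lborel. psi g x t * k t)"
    unfolding continuous_on_sequentially comp_def
  proof (intro allI ballI impI)
    fix X :: "nat \<Rightarrow> real" and a :: real
    assume "(\<forall>n. X n \<in> UNIV) \<and> X \<longlonglongrightarrow> a"
    hence X: "X \<longlonglongrightarrow> a" by simp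
    have "(\<lambda>n. g (X n + t)) \<longlonglongrightarrow> g (a + t)" "(\<lambda>n. g (X n - t)) \<longlonglongrightarrow> g (a - t)" for t
      using g by (auto intro!: continuous_on_tendsto_compose[OF g] tendsto_intros X)
    hence "(\<lambda>n. indicator {0<..pi} t *\<^sub>R (psi g (X n) t * k t))
              \<longlonglongrightarrow> indicator {0<..pi} t *\<^sub>R (psi g a t * k t)" for t
      unfolding psi_def by (intro tendsto_intros)
    thus "(\<lambda>n. LINT t:{0<..pi}|lborel. psi g (X n) t * k t)
            \<longlonglongrightarrow> (LINT t:{0<..pi}|lborel. psi g a t * k t)"
      unfolding set_lebesgue_integral_def
      by (intro integral_dominated_convergence[OF _ _ int] AE_I2 dom) auto
  qed
qed

section \<open>Norms of the function spaces\<close>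

lemma borel_measurable_lebesgue_AE_eq:
  fixes f g :: "real \<Rightarrow> real"
  assumes [measurable]: "g \<in> borel_measurable borel" and AE: "AE x in lborel. f x = g x"
  shows "f \<in> borel_measurable lebesgue"
proof (rule measurableI)
  fix A :: "real set" assume [measurable]: "A \<in> sets borel"
  have "g \<in> borel_measurable lebesgue" by (rule measurable_completion) measurable
  hence A: "g -` A \<inter> space lebesgue \<in> sets lebesgue" by (rule measurable_sets) measurable
  have ae: "AE x in lebesgue. x \<in> g -` A \<inter> space lebesgue \<longleftrightarrow> x \<in> f -` A \<inter> space lebesgue"
    using AE_completion[OF AE] by eventually_elim auto
  show "f -` A \<inter> space lebesgue \<in> sets lebesgue"
    by (rule completion.in_sets_AE[OF ae A]) auto
qed auto

text \<open>
  Stated for arbitrary predicates \<open>P\<close>, since it is applied to the comparison of a function that is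
  only Lebesgue measurable with a Borel one; a Borel null set covers the exceptions.
\<close>

lemma AE_lborel_affine:
  fixes P :: "real \<Rightarrow> bool"
  assumes "AE x in lborel. P x" "c \<noteq> 0"
  shows "AE x in lborel. P (t + c * x)"
proof -
  obtain N where N: "{x \<in> space lborel. \<not> P x} \<subseteq> N" "N \<in> null_sets lborel"
    using assms(1) by (auto simp: eventually_ae_filter)
  hence [measurable]: "N \<in> sets borel" by (auto simp: null_sets_def)
  have "AE x in lborel. t + c * x \<notin> N"
    by (rule AE_borel_affine[OF assms(2) _ AE_not_in[OF N(2)]]) measurable
  thus ?thesis by eventually_elim (use N in auto)
qed

lemma set_integral_lebesgue_eq_lborel:
  fixes q :: "real \<Rightarrow> real"
  assumes [measurable]: "q \<in> borel_measurable borel" "S \<in> sets borel"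
  shows "(LINT t:S|lebesgue. q t) = (LINT t:S|lborel. q t)"
  unfolding set_lebesgue_integral_def by (intro integral_completion) measurable

lemma holds_in_mono: "holds_in X P \<Longrightarrow> (\<And>x. P x \<Longrightarrow> Q x) \<Longrightarrow> holds_in X Q"
  by (cases X) auto

lemma enn2real_ge_1: "1 \<le> p \<Longrightarrow> p \<noteq> \<infinity> \<Longrightarrow> 1 \<le> enn2real p"
  by (cases p) (auto simp: ennreal_1[symmetric] simp del: ennreal_1)

lemma norm_Lp_le:
  assumes p: "1 \<le> p" "p \<noteq> \<infinity>" and per: "periodic_2pi F"
    and F [measurable]: "F \<in> borel_measurable lebesgue" and W: "0 \<le> W"
    and le: "(\<integral>\<^sup>+x. ennreal (\<bar>F x\<bar> powr enn2real p) * indicator {-pi..pi} x \<partial>lebesgue)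
               \<le> ennreal (W powr enn2real p)"
  shows "F \<in> carrier_of (Lp p)" "norm_of (Lp p) F \<le> W"
proof -
  note p1 = enn2real_ge_1[OF p]
  have eq: "ennreal (indicator {-pi..pi} x *\<^sub>R \<bar>F x\<bar> powr enn2real p)
      = ennreal (\<bar>F x\<bar> powr enn2real p) * indicator {-pi..pi} x" for x
    by (auto split: split_indicator)
  have [measurable]: "(\<lambda>x. indicator {-pi..pi} x :: real) \<in> borel_measurable lebesgue"
    by (rule measurable_completion) measurable
  have int: "integrable lebesgue (\<lambda>x. indicator {-pi..pi} x *\<^sub>R \<bar>F x\<bar> powr enn2real p)"
  proof (rule integrableI_bounded)
    have "(\<integral>\<^sup>+x. ennreal (norm (indicator {-pi..pi} x *\<^sub>R \<bar>F x\<bar> powr enn2real p)) \<partial>lebesgue)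
      = (\<integral>\<^sup>+x. ennreal (\<bar>F x\<bar> powr enn2real p) * indicator {-pi..pi} x \<partial>lebesgue)"
      by (intro nn_integral_cong) (auto split: split_indicator)
    also have "\<dots> < \<infinity>" using le_less_trans[OF le ennreal_less_top] by simp
    finally show "(\<integral>\<^sup>+x. ennreal (norm (indicator {-pi..pi} x *\<^sub>R \<bar>F x\<bar> powr enn2real p)) \<partial>lebesgue) < \<infinity>" .
  qed measurable
  thus "F \<in> carrier_of (Lp p)" using p per F by (simp add: set_integrable_def)
  have "ennreal (LINT x:{-pi..pi}|lebesgue. \<bar>F x\<bar> powr enn2real p)
      = (\<integral>\<^sup>+x. ennreal (indicator {-pi..pi} x *\<^sub>R \<bar>F x\<bar> powr enn2real p) \<partial>lebesgue)"
    unfolding set_lebesgue_integral_def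
    by (intro nn_integral_eq_integral[symmetric] int) auto
  also have "\<dots> \<le> ennreal (W powr enn2real p)" unfolding eq by (rule le)
  finally have "(LINT x:{-pi..pi}|lebesgue. \<bar>F x\<bar> powr enn2real p) \<le> W powr enn2real p"
    by (simp add: ennreal_le_iff)
  moreover have "0 \<le> (LINT x:{-pi..pi}|lebesgue. \<bar>F x\<bar> powr enn2real p)"
    by (auto simp: set_lebesgue_integral_def intro!: Bochner_Integration.integral_nonneg)
  ultimately have "norm_of (Lp p) F \<le> (W powr enn2real p) powr (1 / enn2real p)"
    using p p1 by (auto intro!: powr_mono2)
  also have "\<dots> = W" using p1 W by (simp add: powr_powr)
  finally show "norm_of (Lp p) F \<le> W" .
qed

lemma nn_integral_powr_eq_norm_Lp:
  assumes p: "1 \<le> p" "p \<noteq> \<infinity>" and F: "F \<in> carrier_of (Lp p)"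
  shows "(\<integral>\<^sup>+x. ennreal (\<bar>F x\<bar> powr enn2real p) * indicator {-pi..pi} x \<partial>lebesgue)
               = ennreal (norm_of (Lp p) F powr enn2real p)"
proof -
  note p1 = enn2real_ge_1[OF p]
  have int: "set_integrable lebesgue {-pi..pi} (\<lambda>x. \<bar>F x\<bar> powr enn2real p)"
    using F p by simp
  have "(\<integral>\<^sup>+x. ennreal (\<bar>F x\<bar> powr enn2real p) * indicator {-pi..pi} x \<partial>lebesgue)
     = (\<integral>\<^sup>+x. ennreal (indicator {-pi..pi} x *\<^sub>R \<bar>F x\<bar> powr enn2real p) \<partial>lebesgue)"
    by (intro nn_integral_cong) (auto split: split_indicator)
  also have "\<dots> = ennreal (LINT x:{-pi..pi}|lebesgue. \<bar>F x\<bar> powr enn2real p)"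
    unfolding set_lebesgue_integral_def
    by (intro nn_integral_eq_integral int[unfolded set_integrable_def]) auto
  also have "(LINT x:{-pi..pi}|lebesgue. \<bar>F x\<bar> powr enn2real p) = norm_of (Lp p) F powr enn2real p"
  proof -
    have "0 \<le> (LINT x:{-pi..pi}|lebesgue. \<bar>F x\<bar> powr enn2real p)"
      by (auto simp: set_lebesgue_integral_def intro!: Bochner_Integration.integral_nonneg)
    thus ?thesis using p p1 by (simp add: powr_powr)
  qed
  finally show ?thesis .
qed

lemma AE_lebesgue_on_period_iff:
  "(AE x in restrict_space lebesgue {-pi..pi}. P x) \<longleftrightarrow> (AE x in lborel. x \<in> {-pi..pi} \<longrightarrow> P x)"
  by (subst AE_restrict_space_iff) (auto simp: AE_completion_iff)

lemma norm_Linf_le: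
  assumes per: "periodic_2pi F" and F [measurable]: "F \<in> borel_measurable lebesgue" and W: "0 \<le> W"
    and le: "AE x in lborel. x \<in> {-pi..pi} \<longrightarrow> \<bar>F x\<bar> \<le> W"
  shows "F \<in> carrier_of (Lp \<infinity>)" "norm_of (Lp \<infinity>) F \<le> W"
proof -
  have "AE x in restrict_space lebesgue {-pi..pi}. ereal \<bar>F x\<bar> \<le> ereal W"
    using le by (simp add: AE_lebesgue_on_period_iff)
  moreover have "(\<lambda>x. ereal \<bar>F x\<bar>) \<in> borel_measurable (restrict_space lebesgue {-pi..pi})"
    by (rule measurable_restrict_space1) measurable
  ultimately have ess: "ess_bound F \<le> ereal W" unfolding ess_bound_def by (intro esssup_I)
  thus "F \<in> carrier_of (Lp \<infinity>)" using per F by (auto intro: le_less_trans)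
  show "norm_of (Lp \<infinity>) F \<le> W" using ess W by (cases "ess_bound F") auto
qed

lemma AE_le_norm_Linf:
  assumes "F \<in> carrier_of (Lp \<infinity>)"
  shows "AE x in lborel. x \<in> {-pi..pi} \<longrightarrow> \<bar>F x\<bar> \<le> norm_of (Lp \<infinity>) F"
proof -
  have "AE x in restrict_space lebesgue {-pi..pi}. ereal \<bar>F x\<bar> \<le> ess_bound F"
    unfolding ess_bound_def by (rule esssup_AE)
  hence "AE x in lborel. x \<in> {-pi..pi} \<longrightarrow> ereal \<bar>F x\<bar> \<le> ess_bound F"
    by (simp add: AE_lebesgue_on_period_iff)
  moreover have "ess_bound F < \<infinity>" using assms by simp
  ultimately show ?thesis
    by (cases "ess_bound F") (auto elim!: eventually_mono)
qed

lemma bounded_periodic: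
  assumes per: "periodic_2pi F" and F: "continuous_on UNIV F"
  obtains B where "\<And>x. \<bar>F x\<bar> \<le> B"
proof -
  have per': "F (x + 2 * pi) = F x" for x using per by (simp add: periodic_2pi_def)
  have "continuous_on {0..2*pi} F" using F by (rule continuous_on_subset) simp
  then obtain B where B: "\<And>x. x \<in> {0..2*pi} \<Longrightarrow> norm (F x) \<le> B"
    using continuous_on_compact_bound[OF compact_Icc] by metis
  have "\<bar>F x\<bar> \<le> B" for x
  proof -
    obtain m :: int where m: "0 \<le> x - of_int m * (2 * pi)" "x - of_int m * (2 * pi) < 2 * pi"
      by (rule obtain_period_shift)
    have "F x = F (x - of_int m * (2 * pi))"
      using periodic_int_mult[of F "x - of_int m * (2 * pi)" m, OF per'] by simp
    thus ?thesis using B[of "x - of_int m * (2 * pi)"] m by simp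
  qed
  thus ?thesis by (rule that)
qed

lemma abs_le_norm_Cont:
  assumes "F \<in> carrier_of Cont"
  shows "\<bar>F x\<bar> \<le> norm_of Cont F"
proof -
  obtain B where "\<And>x. \<bar>F x\<bar> \<le> B" using assms bounded_periodic[of F] by auto
  hence "bdd_above (range (\<lambda>x. \<bar>F x\<bar>))" by (auto simp: bdd_above_def)
  thus ?thesis by (auto intro: cSUP_upper)
qed

lemma norm_Cont_le: "(\<And>x. \<bar>F x\<bar> \<le> W) \<Longrightarrow> norm_of Cont F \<le> W"
  by (auto intro: cSUP_least)

lemma abs_diff_powr_le:
  fixes a b p :: real
  assumes "0 \<le> p"
  shows "\<bar>a - b\<bar> powr p \<le> 2 powr p * (\<bar>a\<bar> powr p + \<bar>b\<bar> powr p)"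
proof -
  have "\<bar>a - b\<bar> \<le> 2 * max \<bar>a\<bar> \<bar>b\<bar>" by linarith
  hence "\<bar>a - b\<bar> powr p \<le> (2 * max \<bar>a\<bar> \<bar>b\<bar>) powr p" using assms by (intro powr_mono2) auto
  also have "\<dots> = 2 powr p * max \<bar>a\<bar> \<bar>b\<bar> powr p" by (simp add: powr_mult)
  also have "max \<bar>a\<bar> \<bar>b\<bar> powr p \<le> \<bar>a\<bar> powr p + \<bar>b\<bar> powr p" by (simp add: max_def)
  hence "2 powr p * max \<bar>a\<bar> \<bar>b\<bar> powr p \<le> 2 powr p * (\<bar>a\<bar> powr p + \<bar>b\<bar> powr p)"
    by (intro mult_left_mono) auto
  finally show ?thesis .
qed

lemma periodic_psi: "periodic_2pi g \<Longrightarrow> periodic_2pi (\<lambda>x. psi g x t)"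
  unfolding periodic_2pi_def[of "\<lambda>x. psi g x t"] by (simp add: psi_periodic)

text \<open>
  The modulus of continuity is a supremum in the conditionally complete order of the reals, so it
  dominates the norms of \<open>psi\<close> only once these are known to be bounded.
\<close>

lemma psi_bounded_in_space:
  assumes X: "valid_space X" and g: "g \<in> carrier_of X" and [measurable]: "g \<in> borel_measurable borel"
  obtains B where "\<And>t. (\<lambda>x. psi g x t) \<in> carrier_of X" "\<And>t. norm_of X (\<lambda>x. psi g x t) \<le> B"
proof -
  have per: "periodic_2pi g" using g by (cases X) auto
  hence per': "g (x + 2 * pi) = g x" for x by (simp add: periodic_2pi_def)
  have leb: "(\<lambda>x. psi g x t) \<in> borel_measurable lebesgue" for t
    by (rule measurable_completion) measurable
  show ?thesis
  proof (cases X)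
    case (Lp p)
    show ?thesis
    proof (cases "p = \<infinity>")
      case True
      define M where "M = norm_of X g"
      have M: "AE x in lborel. x \<in> {-pi..pi} \<longrightarrow> \<bar>g x\<bar> \<le> M"
        using AE_le_norm_Linf[of g] g Lp True by (simp add: M_def)
      have AE: "AE x in lborel. \<bar>g x\<bar> \<le> M"
        by (rule AE_periodic[OF _ _ M]) (auto simp: per')
      have shifted: "AE x in lborel. \<bar>g (t + 1 * x)\<bar> \<le> M" for t
        by (rule AE_lborel_affine[OF AE]) simp
      have bd: "AE x in lborel. x \<in> {-pi..pi} \<longrightarrow> \<bar>psi g x t\<bar> \<le> 2 * \<bar>M\<bar>" for t
        using shifted[of t] shifted[of "- t"]
      proof eventually_elim
        case (elim x)
        hence "\<bar>g (x + t)\<bar> \<le> M" "\<bar>g (x - t)\<bar> \<le> M" by (auto simp: algebra_simps)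
        thus ?case by (auto simp: psi_def)
      qed
      show ?thesis
        by (rule that[of "2 * \<bar>M\<bar>"]) (use norm_Linf_le[OF periodic_psi[OF per] leb _ bd] Lp True in auto)
    next
      case False
      have p1: "1 \<le> p" using X Lp by simp
      define q where "q = enn2real p"
      have q1: "1 \<le> q" unfolding q_def by (rule enn2real_ge_1[OF p1 False])
      define N where "N = norm_of X g powr q"
      define W where "W = (2 powr q * (N + N)) powr (1 / q)"
      have N: "(\<integral>\<^sup>+x. ennreal (\<bar>g x\<bar> powr q) * indicator {-pi..pi} x \<partial>lborel) = ennreal N"
        using nn_integral_powr_eq_norm_Lp[OF p1 False, of g] g Lp
        by (simp add: N_def q_def nn_integral_completion del: carrier_of.simps norm_of.simps)
      have sh: "(\<integral>\<^sup>+x. ennreal (\<bar>g (x + t)\<bar> powr q) * indicator {-pi..pi} x \<partial>lborel) = ennreal N" for t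
        unfolding N[symmetric]
        by (rule nn_integral_period_shift[where h="\<lambda>x. ennreal (\<bar>g x\<bar> powr q)"]) (auto simp: per')
      have "(\<integral>\<^sup>+x. ennreal (\<bar>psi g x t\<bar> powr q) * indicator {-pi..pi} x \<partial>lebesgue)
              \<le> ennreal (W powr q)" for t
      proof -
        have "(\<integral>\<^sup>+x. ennreal (\<bar>psi g x t\<bar> powr q) * indicator {-pi..pi} x \<partial>lebesgue)
            \<le> (\<integral>\<^sup>+x. ennreal (2 powr q) * (ennreal (\<bar>g (x + t)\<bar> powr q) * indicator {-pi..pi} x
                  + ennreal (\<bar>g (x + (-t))\<bar> powr q) * indicator {-pi..pi} x) \<partial>lborel)"
          unfolding nn_integral_completion
        proof (rule nn_integral_mono)
          fix x
          have "ennreal (\<bar>psi g x t\<bar> powr q)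
              \<le> ennreal (2 powr q * (\<bar>g (x + t)\<bar> powr q + \<bar>g (x - t)\<bar> powr q))"
            unfolding psi_def using q1 by (intro ennreal_leI abs_diff_powr_le) auto
          also have "\<dots> = ennreal (2 powr q) * (ennreal (\<bar>g (x + t)\<bar> powr q) + ennreal (\<bar>g (x - t)\<bar> powr q))"
            by (simp add: ennreal_mult flip: ennreal_plus)
          finally show "ennreal (\<bar>psi g x t\<bar> powr q) * indicator {-pi..pi} x
             \<le> ennreal (2 powr q) * (ennreal (\<bar>g (x + t)\<bar> powr q) * indicator {-pi..pi} x
                  + ennreal (\<bar>g (x + (-t))\<bar> powr q) * indicator {-pi..pi} x)"
            by (simp split: split_indicator)
        qed
        also have "\<dots> = ennreal (2 powr q) * (ennreal N + ennreal N)"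
          by (subst nn_integral_cmult, measurable, subst nn_integral_add, measurable) (simp only: sh)
        also have "\<dots> = ennreal (2 powr q * (N + N))"
          by (simp add: N_def flip: ennreal_plus ennreal_mult)
        also have "2 powr q * (N + N) = W powr q"
          using q1 by (simp add: W_def powr_powr N_def)
        finally show ?thesis .
      qed
      thus ?thesis
        using norm_Lp_le[OF p1 False periodic_psi[OF per] leb, of W] Lp
        by (intro that[of W]) (auto simp: W_def q_def)
    qed
  next
    case Cont
    hence cont: "continuous_on UNIV g" using g by simp
    obtain B where B: "\<And>x. \<bar>g x\<bar> \<le> B" using bounded_periodic[OF per cont] by blast
    have "\<bar>psi g x t\<bar> \<le> 2 * B" for x t
      using B[of "x + t"] B[of "x - t"] by (auto simp: psi_def)
    moreover have "continuous_on UNIV (\<lambda>x. psi g x t)" for t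
      unfolding psi_def
      by (intro continuous_intros continuous_on_compose2[OF cont]) auto
    ultimately show ?thesis using Cont periodic_psi[OF per]
      by (intro that[of "2 * B"]) (auto intro!: cSUP_least)
  qed
qed

text \<open>
  This is the only place where the function space matters: a function of the form
  \<open>\<integral> psi g x t * k t dt\<close> belongs to \<open>X\<close>, with norm at most the integral of \<open>w * \<bar>k\<bar>\<close>, where \<open>w t\<close>
  bounds the norm of \<open>psi\<close>. The integral representation of \<open>F\<close> is required only in the sense of \<open>X\<close>,
  almost everywhere in \<open>L\<^sup>p\<close> and everywhere in \<open>C\<close>; periodicity is required everywhere.
\<close>

lemma kernel_operator:
  assumes X: "valid_space X" and g: "g \<in> carrier_of X"
    and [measurable]: "g \<in> borel_measurable borel" "k \<in> borel_measurable borel" "w \<in> borel_measurable borel"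
    and w0: "\<And>t. 0 \<le> w t"
    and psi: "\<And>t. t \<in> {0<..pi} \<Longrightarrow> norm_of X (\<lambda>x. psi g x t) \<le> w t"
    and W: "0 \<le> W" "(\<integral>\<^sup>+t. ennreal (w t * \<bar>k t\<bar>) * indicator {0<..pi} t \<partial>lborel) \<le> ennreal W"
  shows "holds_in X (\<lambda>x. set_integrable lborel {0<..pi} (\<lambda>t. psi g x t * k t))"
    and "\<And>F. periodic_2pi F \<Longrightarrow>
           holds_in X (\<lambda>x. F x = (LINT t:{0<..pi}|lborel. psi g x t * k t)) \<Longrightarrow>
           F \<in> carrier_of X \<and> norm_of X F \<le> W"
proof -
  have per: "periodic_2pi g" using g by (cases X) auto
  obtain B where psiX: "\<And>t. (\<lambda>x. psi g x t) \<in> carrier_of X"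
    using psi_bounded_in_space[OF X g] by auto
  have Fmeas: "F \<in> borel_measurable lebesgue"
    if "AE x in lborel. F x = (LINT t:{0<..pi}|lborel. psi g x t * k t)" for F
    by (rule borel_measurable_lebesgue_AE_eq[OF _ that])
       (unfold set_lebesgue_integral_def, measurable)
  have "holds_in X (\<lambda>x. set_integrable lborel {0<..pi} (\<lambda>t. psi g x t * k t)) \<and>
        (\<forall>F. periodic_2pi F \<longrightarrow>
           holds_in X (\<lambda>x. F x = (LINT t:{0<..pi}|lborel. psi g x t * k t)) \<longrightarrow>
           F \<in> carrier_of X \<and> norm_of X F \<le> W)"
  proof (cases X)
    case (Lp p)
    show ?thesis
    proof (cases "p = \<infinity>")
      case True
      have bd: "AE x in lborel. x \<in> {-pi..pi} \<longrightarrow> \<bar>psi g x t\<bar> \<le> w t" if "t \<in> {0<..pi}" for t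
        using AE_le_norm_Linf[of "\<lambda>x. psi g x t"] psiX[of t] psi[OF that] Lp True
        by (auto elim!: eventually_mono)
      have op: "AE x in lborel. set_integrable lborel {0<..pi} (\<lambda>t. psi g x t * k t)
                       \<and> \<bar>LINT t:{0<..pi}|lborel. psi g x t * k t\<bar> \<le> W"
        by (rule kernel_operator_Linf[OF per _ _ _ bd W]) measurable
      have "AE x in lborel. set_integrable lborel {0<..pi} (\<lambda>t. psi g x t * k t)"
        using op by (auto elim!: eventually_mono)
      moreover have "F \<in> carrier_of X \<and> norm_of X F \<le> W"
        if "periodic_2pi F" and F: "AE x in lborel. F x = (LINT t:{0<..pi}|lborel. psi g x t * k t)" for F
      proof -
        have "AE x in lborel. x \<in> {-pi..pi} \<longrightarrow> \<bar>F x\<bar> \<le> W"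
          using op F by eventually_elim auto
        thus ?thesis using norm_Linf_le[OF that(1) Fmeas[OF F] W(1)] Lp True by auto
      qed
      ultimately show ?thesis using Lp by (auto simp: AE_completion_iff)
    next
      case False
      have p1: "1 \<le> p" using X Lp by simp
      define q where "q = enn2real p"
      have q1: "1 \<le> q" unfolding q_def by (rule enn2real_ge_1[OF p1 False])
      have bd: "(\<integral>\<^sup>+x. ennreal (\<bar>psi g x t\<bar> powr q) * indicator {-pi..pi} x \<partial>lborel) \<le> ennreal (w t powr q)"
        if "t \<in> {0<..pi}" for t
      proof -
        have "(\<integral>\<^sup>+x. ennreal (\<bar>psi g x t\<bar> powr q) * indicator {-pi..pi} x \<partial>lborel)
           = ennreal (norm_of X (\<lambda>x. psi g x t) powr q)"
          using nn_integral_powr_eq_norm_Lp[OF p1 False, of "\<lambda>x. psi g x t"] psiX[of t] Lp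
          by (simp add: q_def nn_integral_completion del: carrier_of.simps norm_of.simps)
        also have "\<dots> \<le> ennreal (w t powr q)"
          using psi[OF that] q1 Lp False
          by (intro ennreal_leI powr_mono2) auto
        finally show ?thesis .
      qed
      have W': "(\<integral>\<^sup>+t. ennreal (w t * \<bar>k t\<bar>) * indicator {0<..pi} t \<partial>lborel) \<le> ennreal W'"
        if "W < W'" for W' using W(2) by (rule order_trans) (use that in \<open>auto intro: ennreal_leI\<close>)
      note op = kernel_operator_Lp[OF per _ _ _ q1 w0 bd _ W']
      have "AE x in lborel. set_integrable lborel {0<..pi} (\<lambda>t. psi g x t * k t)"
        by (rule op(1)[of "W + 1"]) (use W in auto)
      moreover have "F \<in> carrier_of X \<and> norm_of X F \<le> W"
        if "periodic_2pi F" and F: "AE x in lborel. F x = (LINT t:{0<..pi}|lborel. psi g x t * k t)" for F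
      proof -
        \<comment> \<open>the inequality for finite \<open>p\<close> needs a positive bound, so \<open>W\<close> is approached from above\<close>
        have *: "F \<in> carrier_of X \<and> norm_of X F \<le> W'" if "W < W'" for W'
        proof -
          have "(\<integral>\<^sup>+x. ennreal (\<bar>F x\<bar> powr q) * indicator {-pi..pi} x \<partial>lebesgue)
             = (\<integral>\<^sup>+x. ennreal (\<bar>LINT t:{0<..pi}|lborel. psi g x t * k t\<bar> powr q) * indicator {-pi..pi} x \<partial>lborel)"
            unfolding nn_integral_completion using F by (intro nn_integral_cong_AE) auto
          also have "\<dots> \<le> ennreal (W' powr q)"
            by (rule op(2)) (use that W in auto)
          finally show ?thesis
            using norm_Lp_le[OF p1 False \<open>periodic_2pi F\<close> Fmeas[OF F], of W'] Lp W that
            by (auto simp: q_def)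
        qed
        thus ?thesis using *[of "W + 1"] dense_ge[of W "norm_of X F"] by auto
      qed
      ultimately show ?thesis using Lp by (auto simp: AE_completion_iff)
    qed
  next
    case Cont
    have bd: "\<bar>psi g x t\<bar> \<le> w t" if "t \<in> {0<..pi}" for x t
      using abs_le_norm_Cont[of "\<lambda>x. psi g x t" x] psiX[of t] psi[OF that] Cont by auto
    have "continuous_on UNIV g" using g Cont by simp
    note op = kernel_operator_Cont[OF this _ _ bd W]
    have "F \<in> carrier_of X \<and> norm_of X F \<le> W"
      if "periodic_2pi F" and "\<forall>x. F x = (LINT t:{0<..pi}|lborel. psi g x t * k t)" for F
    proof -
      have F: "F = (\<lambda>x. LINT t:{0<..pi}|lborel. psi g x t * k t)" using that(2) by auto
      show ?thesis using that(1) op(2,3) norm_Cont_le[of F W] Cont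
        by (auto simp: F simp del: norm_of.simps)
    qed
    thus ?thesis using op(1) Cont by auto
  qed
  thus "holds_in X (\<lambda>x. set_integrable lborel {0<..pi} (\<lambda>t. psi g x t * k t))"
    and "\<And>F. periodic_2pi F \<Longrightarrow>
           holds_in X (\<lambda>x. F x = (LINT t:{0<..pi}|lborel. psi g x t * k t)) \<Longrightarrow>
           F \<in> carrier_of X \<and> norm_of X F \<le> W" by blast+
qed

section \<open>Trigonometric kernels, weights and moduli of continuity\<close>

text \<open>
  Jordan's inequality: the sine is concave on \<open>[0, \<pi>]\<close>, hence above its chord over \<open>[0, \<pi>/2]\<close>.
\<close>

lemma sin_ge_chord:
  fixes s :: real
  assumes "0 \<le> s" "s \<le> pi / 2"
  shows "2 * s / pi \<le> sin s"
proof -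
  have "convex_on {0..pi} (\<lambda>x. - sin x)"
  proof (rule f''_ge0_imp_convex[where f'="\<lambda>x. - cos x" and f''=sin])
    show "\<And>x. x \<in> {0..pi} \<Longrightarrow> 0 \<le> sin x" by (auto intro: sin_ge_zero)
  qed (auto intro!: derivative_eq_intros)
  from convex_onD[OF this, of "2 * s / pi" 0 "pi / 2"] assms
  show ?thesis by (simp add: field_simps)
qed

lemma sin_half_ge:
  fixes t :: real
  assumes "0 \<le> t" "t \<le> pi"
  shows "t / pi \<le> sin (t / 2)"
  using sin_ge_chord[of "t / 2"] assms by simp

text \<open>
  The part \<open>1/2 * cot (t / 2)\<close> is independent of \<open>k\<close>. It is the kernel of the conjugate function, and
  it cancels when an average of conjugate partial sums is compared with the conjugate function.
\<close>

lemma conjugate_Dirichlet_kernel: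
  fixes t :: real
  assumes "sin (t / 2) \<noteq> 0"
  shows "(\<Sum>\<nu>=1..k. sin (real \<nu> * t))
       = 1 / 2 * cot (t / 2) - cos ((real k + 1 / 2) * t) / (2 * sin (t / 2))"
proof -
  have "2 * sin (t / 2) * (\<Sum>\<nu>=1..k. sin (real \<nu> * t)) = cos (t / 2) - cos ((real k + 1 / 2) * t)"
  proof (induction k)
    case (Suc k)
    have "2 * sin (t / 2) * sin (real (Suc k) * t)
        = cos (real (Suc k) * t - t / 2) - cos (real (Suc k) * t + t / 2)"
      by (simp add: cos_add cos_diff)
    also have "real (Suc k) * t - t / 2 = (real k + 1 / 2) * t" by (simp add: algebra_simps)
    also have "real (Suc k) * t + t / 2 = (real (Suc k) + 1 / 2) * t" by (simp add: algebra_simps)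
    finally show ?case using Suc by (simp add: distrib_left)
  qed simp
  with assms show ?thesis by (simp add: cot_def field_simps)
qed

lemma abs_cos_quotient_le:
  fixes t c :: real
  assumes t: "t \<in> {0<..pi}"
  shows "\<bar>c / (2 * sin (t / 2))\<bar> \<le> pi / 2 * (\<bar>c\<bar> / t)"
proof -
  have s: "t / pi \<le> sin (t / 2)" using t by (intro sin_half_ge) auto
  have "0 < t / pi" using t by simp
  with s have sp: "0 < sin (t / 2)" by linarith
  have "\<bar>c\<bar> / (2 * sin (t / 2)) \<le> \<bar>c\<bar> / (2 * (t / pi))"
    using s t sp by (intro divide_left_mono mult_pos_pos) auto
  thus ?thesis using s \<open>0 < t / pi\<close> by (simp add: abs_divide mult_ac)
qed

lemma abs_half_cot_le: "t \<in> {0<..pi} \<Longrightarrow> \<bar>1 / 2 * cot (t / 2)\<bar> \<le> pi / 2 * (1 / t)"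
proof -
  assume t: "t \<in> {0<..pi}"
  have "\<bar>cos (t / 2) / (2 * sin (t / 2))\<bar> \<le> pi / 2 * (\<bar>cos (t / 2)\<bar> / t)"
    by (rule abs_cos_quotient_le[OF t])
  also have "\<dots> \<le> pi / 2 * (1 / t)"
    using t by (intro mult_left_mono divide_right_mono) auto
  finally show ?thesis by (simp add: cot_def)
qed

lemma borel_measurable_cot [measurable]: "(\<lambda>t. cot (t / 2) :: real) \<in> borel_measurable borel"
  unfolding cot_def by measurable

lemma sin_half_pos: "t \<in> {0<..pi} \<Longrightarrow> 0 < sin (t / 2)"
  by (intro sin_gt_zero) auto

text \<open>
  Up to the factor \<open>1 / (2 * sin (t / 2))\<close>, this is the \<open>k\<close>-dependent part of the conjugate Dirichlet
  kernel, averaged with the weights \<open>b\<close>.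
\<close>

definition cosine_mean :: "(nat \<Rightarrow> real) \<Rightarrow> real \<Rightarrow> real" where
  "cosine_mean b t = (\<Sum>k. b k * cos ((real k + 1 / 2) * t))"

lemma borel_measurable_cosine_mean [measurable]: "cosine_mean b \<in> borel_measurable borel"
  unfolding cosine_mean_def[abs_def] by measurable

text \<open>
  In this context \<open>b\<close> is a row of a summation matrix and \<open>A\<close> its variation with lag \<open>r\<close>.
\<close>

context
  fixes b :: "nat \<Rightarrow> real" and r :: nat and A :: real
  assumes b0: "\<And>k. 0 \<le> b k" and b1: "b sums 1" and r: "1 \<le> r"
    and A: "A = (\<Sum>k. \<bar>b k - b (k + r)\<bar>)"
begin

lemma summable_weights: "summable b" "summable (\<lambda>k. b (k + r))"
  using b1 by (auto simp: sums_iff intro: summable_ignore_initial_segment)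

lemma summable_lag_variation: "summable (\<lambda>k. \<bar>b k - b (k + r)\<bar>)"
proof (rule summable_comparison_test')
  show "summable (\<lambda>k. b k + b (k + r))" by (intro summable_add summable_weights)
  show "norm \<bar>b k - b (k + r)\<bar> \<le> b k + b (k + r)" for k
    using b0[of k] b0[of "k + r"] by simp
qed

lemma lag_variation_le_2: "A \<le> 2"
proof -
  have "A \<le> (\<Sum>k. b k + b (k + r))" unfolding A
  proof (intro suminf_le summable_lag_variation summable_add summable_weights)
    show "\<bar>b k - b (k + r)\<bar> \<le> b k + b (k + r)" for k
      using b0[of k] b0[of "k + r"] by simp
  qed
  also have "\<dots> = (\<Sum>k. b k) + (\<Sum>k. b (k + r))"
    by (intro suminf_add[symmetric] summable_weights)
  also have "(\<Sum>k. b (k + r)) = (\<Sum>k. b k) - (\<Sum>k<r. b k)"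
    by (intro suminf_minus_initial_segment summable_weights)
  also have "0 \<le> (\<Sum>k<r. b k)" by (intro sum_nonneg b0)
  hence "(\<Sum>k. b k) + ((\<Sum>k. b k) - (\<Sum>k<r. b k)) \<le> 2" using b1 by (simp add: sums_iff)
  finally show ?thesis .
qed

text \<open>
  The sum of all the differences \<open>b k - b (k + r)\<close> telescopes to the sum of the first \<open>r\<close> weights.
\<close>

lemma initial_weights_le_lag_variation: "(\<Sum>k<r. b k) \<le> A"
proof -
  have "(\<Sum>k<r. b k) = (\<Sum>k. b k) - (\<Sum>k. b (k + r))"
    using suminf_minus_initial_segment[OF summable_weights(1), of r] by simp
  also have "\<dots> = (\<Sum>k. b k - b (k + r))"
    by (intro suminf_diff summable_weights)
  also have "\<dots> \<le> A" unfolding A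
    by (intro suminf_le summable_lag_variation summable_diff summable_weights) auto
  finally show ?thesis .
qed

text \<open>
  If the variation vanished, \<open>b\<close> would be \<open>r\<close>-periodic with vanishing initial weights, hence zero.
\<close>

lemma lag_variation_pos: "0 < A"
proof (rule ccontr)
  assume "\<not> 0 < A"
  moreover have "0 \<le> (\<Sum>k<r. b k)" by (intro sum_nonneg b0)
  ultimately have A0: "A = 0" and init: "(\<Sum>k<r. b k) = 0"
    using initial_weights_le_lag_variation by auto
  have per: "b k = b (k + r)" for k
    using A0 suminf_eq_zero_iff[OF summable_lag_variation] unfolding A by auto
  have "b k = 0" for k
  proof (induction k rule: less_induct)
    case (less k)
    show ?case
    proof (cases "k < r")
      case True
      thus ?thesis using init b0 by (subst (asm) sum_nonneg_eq_0_iff) auto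
    next
      case False
      thus ?thesis using per[of "k - r"] less[of "k - r"] r by simp
    qed
  qed
  hence "b = (\<lambda>_. 0)" by auto
  with b1 show False using sums_unique2[of b 1 0] by auto
qed

lemma summable_trig:
  assumes "\<And>k. \<bar>h k\<bar> \<le> (1::real)"
  shows "summable (\<lambda>k. b k * h k)" "\<bar>\<Sum>k. b k * h k\<bar> \<le> 1"
proof -
  have le: "norm (b k * h k) \<le> b k" for k
    using assms[of k] b0[of k] by (simp add: abs_mult mult_left_le)
  show "summable (\<lambda>k. b k * h k)" by (rule summable_comparison_test'[OF summable_weights(1) le])
  have s: "summable (\<lambda>k. norm (b k * h k))"
    by (rule summable_comparison_test'[OF summable_weights(1)]) (use le in auto)
  have "\<bar>\<Sum>k. b k * h k\<bar> \<le> (\<Sum>k. norm (b k * h k))" using summable_norm[OF s] by simp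
  also have "\<dots> \<le> (\<Sum>k. b k)" by (intro suminf_le le s summable_weights)
  finally show "\<bar>\<Sum>k. b k * h k\<bar> \<le> 1" using b1 by (simp add: sums_iff)
qed

lemma abs_cosine_mean_le_1: "\<bar>cosine_mean b t\<bar> \<le> 1"
  unfolding cosine_mean_def by (rule summable_trig) simp

text \<open>
  Abel summation with lag \<open>r\<close>. Multiplying the cosine by \<open>2 * sin (r * t / 2)\<close> gives a difference of
  two sines whose indices differ by \<open>r\<close>. Collecting equal sines leaves the coefficients
  \<open>b k - b (k + r)\<close>, which contribute at most \<open>A\<close>, and the first \<open>r\<close> weights, which contribute at most
  \<open>A\<close> once more.
\<close>

lemma abs_cosine_mean_sin_le: "\<bar>cosine_mean b t\<bar> * \<bar>sin (real r * t / 2)\<bar> \<le> A"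
proof -
  define S where "S k = sin ((real k + 1 / 2 + real r / 2) * t)" for k
  define S' where "S' k = sin ((real k + 1 / 2 - real r / 2) * t)" for k
  have S': "S' (k + r) = S k" for k
  proof -
    have "real (k + r) + 1 / 2 - real r / 2 = real k + 1 / 2 + real r / 2" by simp
    thus ?thesis unfolding S_def S'_def by (simp only:)
  qed
  have sumS: "summable (\<lambda>k. b k * S k)" and sumS': "summable (\<lambda>k. b k * S' k)"
    by (auto intro!: summable_trig simp: S_def S'_def)
  have sumSr: "summable (\<lambda>k. b (k + r) * S k)"
    using summable_ignore_initial_segment[OF sumS', of r] by (simp add: S')
  have "2 * sin (real r * t / 2) * (b k * cos ((real k + 1 / 2) * t)) = b k * S k - b k * S' k" for k
  proof -
    have "S k = sin ((real k + 1 / 2) * t + real r * t / 2)"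
      "S' k = sin ((real k + 1 / 2) * t - real r * t / 2)"
      by (simp_all add: S_def S'_def field_simps)
    moreover have "2 * sin \<beta> * (c * cos \<alpha>) = c * sin (\<alpha> + \<beta>) - c * sin (\<alpha> - \<beta>)" for c \<alpha> \<beta> :: real
      by (simp add: sin_add sin_diff algebra_simps)
    ultimately show ?thesis by simp
  qed
  hence "2 * sin (real r * t / 2) * cosine_mean b t = (\<Sum>k. b k * S k - b k * S' k)"
    unfolding cosine_mean_def by (subst suminf_mult[symmetric]) (auto intro!: summable_trig)
  also have "\<dots> = (\<Sum>k. b k * S k) - (\<Sum>k. b k * S' k)"
    by (intro suminf_diff[symmetric] sumS sumS')
  also have "(\<Sum>k. b k * S' k) = (\<Sum>k. b (k + r) * S k) + (\<Sum>k<r. b k * S' k)"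
    using suminf_split_initial_segment[OF sumS', of r] by (simp add: S')
  also have "(\<Sum>k. b k * S k) - ((\<Sum>k. b (k + r) * S k) + (\<Sum>k<r. b k * S' k))
      = (\<Sum>k. b k * S k - b (k + r) * S k) - (\<Sum>k<r. b k * S' k)"
    by (simp add: suminf_diff[OF sumS sumSr])
  finally have eq: "2 * sin (real r * t / 2) * cosine_mean b t
      = (\<Sum>k. b k * S k - b (k + r) * S k) - (\<Sum>k<r. b k * S' k)" .
  have le: "norm (b k * S k - b (k + r) * S k) \<le> \<bar>b k - b (k + r)\<bar>" for k
  proof -
    have "\<bar>b k - b (k + r)\<bar> * \<bar>S k\<bar> \<le> \<bar>b k - b (k + r)\<bar> * 1"
      by (intro mult_left_mono) (auto simp: S_def)
    thus ?thesis by (simp add: abs_mult flip: left_diff_distrib)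
  qed
  have s: "summable (\<lambda>k. norm (b k * S k - b (k + r) * S k))"
    by (rule summable_comparison_test'[OF summable_lag_variation]) (use le in auto)
  have "\<bar>\<Sum>k. b k * S k - b (k + r) * S k\<bar> \<le> (\<Sum>k. norm (b k * S k - b (k + r) * S k))"
    using summable_norm[OF s] by simp
  also have "\<dots> \<le> A" unfolding A by (intro suminf_le le s summable_lag_variation)
  finally have 1: "\<bar>\<Sum>k. b k * S k - b (k + r) * S k\<bar> \<le> A" .
  have "\<bar>\<Sum>k<r. b k * S' k\<bar> \<le> (\<Sum>k<r. \<bar>b k * S' k\<bar>)" by (rule sum_abs)
  also have "\<dots> \<le> (\<Sum>k<r. b k)"
    using b0 by (intro sum_mono) (auto simp: abs_mult S'_def mult_left_le)
  also note initial_weights_le_lag_variation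
  finally have "\<bar>2 * sin (real r * t / 2) * cosine_mean b t\<bar> \<le> 2 * A" using 1 eq by linarith
  thus ?thesis by (simp add: abs_mult mult_ac)
qed

end

lemma
  assumes "modulus_type \<omega>"
  shows modulus_type_nonneg: "t \<in> {0..2*pi} \<Longrightarrow> 0 \<le> \<omega> t"
    and modulus_type_mono: "0 \<le> s \<Longrightarrow> s \<le> t \<Longrightarrow> t \<le> 2 * pi \<Longrightarrow> \<omega> s \<le> \<omega> t"
  using assms mono_onD[of "{0..2*pi}" \<omega> 0 t] mono_onD[of "{0..2*pi}" \<omega> s t]
  by (auto simp: modulus_type_def)

lemma modulus_type_mult:
  assumes om: "modulus_type \<omega>" and "0 \<le> t" "real (Suc n) * t \<le> 2 * pi"
  shows "\<omega> (real (Suc n) * t) \<le> real (Suc n) * \<omega> t"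
  using assms(3)
proof (induction n)
  case (Suc n)
  have eq: "real (Suc (Suc n)) * t = t + real (Suc n) * t" by (simp add: algebra_simps)
  have "\<omega> (t + real (Suc n) * t) \<le> \<omega> t + \<omega> (real (Suc n) * t)"
  proof -
    have "t \<le> real (Suc n) * t" "t + real (Suc n) * t \<le> 2 * pi"
      using \<open>0 \<le> t\<close> Suc.prems eq by (auto simp: distrib_right)
    thus ?thesis using om \<open>0 \<le> t\<close> unfolding modulus_type_def by auto
  qed
  also have "\<dots> \<le> \<omega> t + real (Suc n) * \<omega> t"
    using Suc eq \<open>0 \<le> t\<close> by simp
  finally show ?case unfolding eq by (simp add: algebra_simps)
qed simp

text \<open>
  Subadditivity prevents a modulus of continuity from decaying faster than linearly: some multiple of
  \<open>t\<close> lies between \<open>\<pi>\<close> and \<open>\<pi> + t\<close>, and there are at most \<open>2\<pi> / t\<close> steps.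
\<close>

lemma modulus_type_linear_lower_bound:
  assumes om: "modulus_type \<omega>" and t: "0 < t" "t \<le> pi"
  shows "\<omega> pi * t \<le> 2 * pi * \<omega> t"
proof -
  define n where "n = nat \<lfloor>pi / t\<rfloor>"
  have q: "1 \<le> pi / t" using t by simp
  have n: "real n \<le> pi / t" "pi / t < real n + 1" unfolding n_def using q by linarith+
  have lo: "pi \<le> real (Suc n) * t" using n(2) t by (simp add: field_simps)
  have hi: "real (Suc n) * t \<le> pi + t" using n(1) t by (simp add: field_simps)
  have "\<omega> pi \<le> \<omega> (real (Suc n) * t)"
    using lo hi t by (intro modulus_type_mono[OF om]) auto
  also have "\<dots> \<le> real (Suc n) * \<omega> t"
    using hi t by (intro modulus_type_mult[OF om]) auto
  finally have "\<omega> pi * t \<le> real (Suc n) * \<omega> t * t" using t by (intro mult_right_mono) auto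
  also have "\<dots> = (real (Suc n) * t) * \<omega> t" by simp
  also have "\<dots> \<le> (2 * pi) * \<omega> t"
    using hi t modulus_type_nonneg[OF om, of t] by (intro mult_right_mono) auto
  finally show ?thesis .
qed

section \<open>Weighted integrals of the averaged kernel\<close>

text \<open>
  Near a zero of \<open>sin (r * t / 2)\<close> the two bounds for the cosine mean, \<open>1\<close> and \<open>A / \<bar>sin (r * t / 2)\<bar>\<close>,
  are dominated by this function of the distance \<open>s\<close> to that zero.
\<close>

definition lag_majorant :: "real \<Rightarrow> real \<Rightarrow> real" where
  "lag_majorant A s = (if s \<le> A then 1 else pi * A / s)"

lemma borel_measurable_lag_majorant [measurable]: "lag_majorant A \<in> borel_measurable borel"
  unfolding lag_majorant_def[abs_def] by measurable

lemma lag_majorant_nonneg: "0 \<le> A \<Longrightarrow> 0 \<le> lag_majorant A s"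
  by (auto simp: lag_majorant_def)

lemma lag_bound_near_zero:
  fixes c s A :: real
  assumes r: "1 \<le> r" and s: "\<bar>s\<bar> \<le> pi / real r"
    and c1: "\<bar>c\<bar> \<le> 1" and cA: "\<bar>c\<bar> * \<bar>sin (real r * s / 2)\<bar> \<le> A" and A: "0 < A"
  shows "\<bar>c\<bar> \<le> lag_majorant A \<bar>s\<bar>"
proof (cases "\<bar>s\<bar> \<le> A")
  case False
  have r0: "0 < real r" using r by simp
  have "\<bar>s\<bar> \<le> real r * \<bar>s\<bar>" using r by (simp add: mult_le_cancel_right1)
  moreover have "real r * \<bar>s\<bar> \<le> pi" using s r0 by (simp add: field_simps)
  ultimately have "\<bar>s\<bar> / pi \<le> real r * \<bar>s\<bar> / pi" "real r * \<bar>s\<bar> / pi \<le> sin (real r * \<bar>s\<bar> / 2)"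
    using sin_half_ge[of "real r * \<bar>s\<bar>"] by (auto simp: divide_right_mono)
  moreover have "sin (real r * \<bar>s\<bar> / 2) \<le> \<bar>sin (real r * s / 2)\<bar>"
    by (cases "0 \<le> s") auto
  ultimately have "\<bar>s\<bar> / pi \<le> \<bar>sin (real r * s / 2)\<bar>" by linarith
  hence "\<bar>c\<bar> * (\<bar>s\<bar> / pi) \<le> \<bar>c\<bar> * \<bar>sin (real r * s / 2)\<bar>" by (intro mult_left_mono) auto
  with cA have "\<bar>c\<bar> * (\<bar>s\<bar> / pi) \<le> A" by linarith
  moreover have "0 < \<bar>s\<bar>" using False A by linarith
  ultimately show ?thesis using False by (simp add: lag_majorant_def field_simps)
qed (use c1 in \<open>simp add: lag_majorant_def\<close>)

text \<open>
  Beyond \<open>\<pi> / r\<close> the nearest zero is one of the \<open>2\<pi>m / r\<close> with \<open>1 \<le> m \<le> r\<close>; a shift by it changes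
  \<open>sin (r * t / 2)\<close> only in sign.
\<close>

lemma nearest_zero_of_sine:
  fixes t :: real
  assumes r: "1 \<le> r" and t: "pi / real r < t" "t \<le> pi"
  obtains m where "m \<in> {1..r}" "\<bar>t - 2 * pi * real m / real r\<bar> \<le> pi / real r"
    "\<bar>sin (real r * (t - 2 * pi * real m / real r) / 2)\<bar> = \<bar>sin (real r * t / 2)\<bar>"
proof -
  have r0: "0 < real r" using r by simp
  define q where "q = real r * t / (2 * pi)"
  have q: "1 / 2 < q" "q \<le> real r / 2"
    using t r0 by (auto simp: q_def field_simps)
  \<comment> \<open>rounding to the nearest integer, ties upwards\<close>
  define m where "m = nat \<lfloor>q + 1 / 2\<rfloor>"
  have m: "real m \<le> q + 1 / 2" "q + 1 / 2 < real m + 1" unfolding m_def using q by linarith+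
  have "m \<noteq> 0" using m(2) q by auto
  moreover have "real m < real r + 1" using m(1) q r by linarith
  ultimately have "m \<in> {1..r}" by auto
  moreover have "t - 2 * pi * real m / real r = (q - real m) * (2 * pi / real r)"
    using r0 by (simp add: q_def field_simps)
  moreover have "\<bar>q - real m\<bar> \<le> 1 / 2" using m by linarith
  hence "\<bar>(q - real m) * (2 * pi / real r)\<bar> \<le> 1 / 2 * (2 * pi / real r)"
    unfolding abs_mult by (intro mult_mono) auto
  moreover have shift: "real r * (t - 2 * pi * real m / real r) / 2 = real r * t / 2 - pi * real m"
    using r0 by (simp add: field_simps)
  have "sin (real r * (t - 2 * pi * real m / real r) / 2) = sin (real r * t / 2) * (-1) ^ m"
    unfolding shift by (simp add: sin_diff mult.commute[of pi])
  hence "\<bar>sin (real r * (t - 2 * pi * real m / real r) / 2)\<bar> = \<bar>sin (real r * t / 2)\<bar>"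
    by (simp add: abs_mult power_abs)
  ultimately show ?thesis using that[of m] by simp
qed

text \<open>
  In this context \<open>w\<close> is a constant multiple of the modulus of continuity. The constant of the first
  condition on the majorant \<open>H\<close> is absorbed into \<open>H\<close>, which leaves the single constant \<open>c\<close>.
\<close>

context
  fixes w H :: "real \<Rightarrow> real" and c :: real
  assumes w [measurable]: "w \<in> borel_measurable borel" and w0: "\<And>t. 0 \<le> w t"
    and w_mono: "\<And>s t. 0 < s \<Longrightarrow> s \<le> t \<Longrightarrow> t \<le> pi \<Longrightarrow> w s \<le> w t"
    and w_lin: "\<And>t. 0 < t \<Longrightarrow> t \<le> pi \<Longrightarrow> w pi * t \<le> 2 * pi * w t"
    and H0: "\<And>u. u \<in> {0<..pi} \<Longrightarrow> 0 \<le> H u" and c: "0 \<le> c"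
    and tail: "\<And>u. u \<in> {0<..pi} \<Longrightarrow>
      (\<integral>\<^sup>+t. ennreal (w t / t\<^sup>2) * indicator {u..pi} t \<partial>lborel) \<le> ennreal (H u)"
    and prim: "\<And>u. u \<in> {0<..pi} \<Longrightarrow>
      (\<integral>\<^sup>+t. ennreal (H t) * indicator {0<..u} t \<partial>lebesgue) \<le> ennreal (c * (u * H u))"
begin

text \<open>
  Tonelli's theorem, starting from \<open>w t / t = \<integral>\<^sub>0\<^sup>t w t / t\<^sup>2 ds\<close>: the inner integral over \<open>t \<ge> s\<close> is at
  most \<open>H s\<close>, and the integral of \<open>H\<close> is controlled by assumption. The case \<open>u = \<pi>\<close> is a Dini
  condition for \<open>w\<close>.
\<close>

lemma dini_integral_le:
  assumes u: "u \<in> {0<..pi}"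
  shows "(\<integral>\<^sup>+t. ennreal (w t / t) * indicator {0<..u} t \<partial>lborel) \<le> ennreal (c * (u * H u))"
proof -
  have "ennreal (w t / t) * indicator {0<..u} t
      = (\<integral>\<^sup>+s. ennreal (w t / t\<^sup>2) * indicator {0<..u} t * indicator {0<..t} s \<partial>lborel)" for t
  proof (cases "t \<in> {0<..u}")
    case True
    hence "(\<integral>\<^sup>+s. ennreal (w t / t\<^sup>2) * indicator {0<..u} t * indicator {0<..t} s \<partial>lborel)
        = ennreal (w t / t\<^sup>2) * ennreal t"
      by (subst nn_integral_cmult_indicator) auto
    also have "\<dots> = ennreal (w t / t)"
      using True w0[of t] by (simp add: power2_eq_square flip: ennreal_mult)
    finally show ?thesis using True by simp
  qed simp
  hence "(\<integral>\<^sup>+t. ennreal (w t / t) * indicator {0<..u} t \<partial>lborel)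
     = (\<integral>\<^sup>+t. \<integral>\<^sup>+s. ennreal (w t / t\<^sup>2) * indicator {0<..u} t * indicator {0<..t} s \<partial>lborel \<partial>lborel)"
    by simp
  also have "\<dots> = (\<integral>\<^sup>+t. \<integral>\<^sup>+s. ennreal (w t / t\<^sup>2) * indicator {0<..u} t *
                       (if 0 < s \<and> s \<le> t then 1 else 0) \<partial>lborel \<partial>lborel)"
    by (intro nn_integral_cong) (auto split: split_indicator)
  also have "\<dots> = (\<integral>\<^sup>+s. \<integral>\<^sup>+t. ennreal (w t / t\<^sup>2) * indicator {0<..u} t *
                       (if 0 < s \<and> s \<le> t then 1 else 0) \<partial>lborel \<partial>lborel)"
    by (rule lborel_pair.Fubini'[symmetric]) measurable
  also have "\<dots> \<le> (\<integral>\<^sup>+s. ennreal (H s) * indicator {0<..u} s \<partial>lebesgue)"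
    unfolding nn_integral_completion
  proof (rule nn_integral_mono)
    fix s :: real
    show "(\<integral>\<^sup>+t. ennreal (w t / t\<^sup>2) * indicator {0<..u} t * (if 0 < s \<and> s \<le> t then 1 else 0) \<partial>lborel)
        \<le> ennreal (H s) * indicator {0<..u} s"
    proof (cases "s \<in> {0<..u}")
      case True
      have "(\<integral>\<^sup>+t. ennreal (w t / t\<^sup>2) * indicator {0<..u} t * (if 0 < s \<and> s \<le> t then 1 else 0) \<partial>lborel)
         \<le> (\<integral>\<^sup>+t. ennreal (w t / t\<^sup>2) * indicator {s..pi} t \<partial>lborel)"
        using u by (intro nn_integral_mono) (auto split: split_indicator)
      also have "\<dots> \<le> ennreal (H s)" using True u by (intro tail) auto
      finally show ?thesis using True by simp
    next
      case False
      hence "(\<integral>\<^sup>+t. ennreal (w t / t\<^sup>2) * indicator {0<..u} t * (if 0 < s \<and> s \<le> t then 1 else 0) \<partial>lborel)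
         = (\<integral>\<^sup>+t. 0 \<partial>(lborel :: real measure))"
        by (intro nn_integral_cong) (auto split: split_indicator)
      thus ?thesis by simp
    qed
  qed
  also note prim[OF u]
  finally show ?thesis .
qed

text \<open>
  The zero of \<open>sin (r * t / 2)\<close> at the origin: \<open>w t / t\<close> is integrated up to \<open>A\<close>, and
  \<open>\<pi> * A * (w t / t\<^sup>2)\<close> beyond \<open>A\<close>.
\<close>

lemma weighted_lag_majorant_le:
  assumes A: "A \<in> {0<..pi}"
  shows "(\<integral>\<^sup>+t. ennreal (w t * (lag_majorant A t / t)) * indicator {0<..pi} t \<partial>lborel)
           \<le> ennreal ((c + pi) * (A * H A))"
proof -
  have "(\<integral>\<^sup>+t. ennreal (w t * (lag_majorant A t / t)) * indicator {0<..pi} t \<partial>lborel)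
     \<le> (\<integral>\<^sup>+t. ennreal (w t / t) * indicator {0<..A} t
          + ennreal (pi * A) * (ennreal (w t / t\<^sup>2) * indicator {A..pi} t) \<partial>lborel)"
  proof (rule nn_integral_mono)
    fix t
    show "ennreal (w t * (lag_majorant A t / t)) * indicator {0<..pi} t
        \<le> ennreal (w t / t) * indicator {0<..A} t
          + ennreal (pi * A) * (ennreal (w t / t\<^sup>2) * indicator {A..pi} t)"
    proof (cases "t \<in> {0<..pi}")
      case True
      show ?thesis
      proof (cases "t \<le> A")
        case le: True
        have "ennreal (w t * (lag_majorant A t / t)) * indicator {0<..pi} t
            = ennreal (w t / t) * indicator {0<..A} t"
          using True le by (simp add: lag_majorant_def)
        thus ?thesis by (simp add: add_increasing2)
      next
        case False
        have eq: "w t * (lag_majorant A t / t) = pi * A * (w t / t\<^sup>2)"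
          using False by (simp add: lag_majorant_def power2_eq_square)
        have "ennreal (w t * (lag_majorant A t / t)) = ennreal (pi * A) * ennreal (w t / t\<^sup>2)"
          unfolding eq using A w0[of t] by (intro ennreal_mult) auto
        thus ?thesis using True False A by simp
      qed
    qed simp
  qed
  also have "\<dots> = (\<integral>\<^sup>+t. ennreal (w t / t) * indicator {0<..A} t \<partial>lborel)
     + ennreal (pi * A) * (\<integral>\<^sup>+t. ennreal (w t / t\<^sup>2) * indicator {A..pi} t \<partial>lborel)"
    by (subst nn_integral_add, measurable) (simp add: nn_integral_cmult)
  also have "\<dots> \<le> ennreal (c * (A * H A)) + ennreal (pi * A) * ennreal (H A)"
    by (intro add_mono mult_left_mono dini_integral_le tail A) auto
  also have "\<dots> = ennreal ((c + pi) * (A * H A))"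
    using c A H0[of A] by (simp add: algebra_simps flip: ennreal_mult ennreal_plus)
  finally show ?thesis .
qed

text \<open>
  The zeros other than the origin. A direct computation would give \<open>A * ln (1 / A)\<close> here. Comparing
  \<open>w pi\<close> with \<open>w s / s\<close> instead, by the linear lower bound for \<open>w\<close>, reduces this integral to the
  one at the origin, on either side of the zero \<open>d\<close>.
\<close>

lemma reflected_lag_majorant_le:
  assumes A: "A \<in> {0<..pi}"
  shows "ennreal (w pi) * (\<integral>\<^sup>+s. ennreal (lag_majorant A \<bar>s - d\<bar>) * indicator {-pi..pi} (s - d) \<partial>lborel)
           \<le> ennreal (4 * pi * ((c + pi) * (A * H A)))"
proof -
  let ?B = "(c + pi) * (A * H A)"
  let ?I = "\<integral>\<^sup>+s. ennreal (lag_majorant A s) * indicator {0<..pi} s \<partial>lborel"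
  have B0: "0 \<le> ?B" using c A H0[of A] by auto
  have "(\<integral>\<^sup>+s. ennreal (lag_majorant A \<bar>s - d\<bar>) * indicator {-pi..pi} (s - d) \<partial>lborel)
      = (\<integral>\<^sup>+s. ennreal (lag_majorant A \<bar>s\<bar>) * indicator {-pi..pi} s \<partial>lborel)"
    by (subst nn_integral_real_affine[where c=1 and t=d]) auto
  also have "\<dots> \<le> (\<integral>\<^sup>+s. ennreal (lag_majorant A s) * indicator {0<..pi} s
        + ennreal (lag_majorant A (- s)) * indicator {0<..pi} (- s) \<partial>lborel)"
  proof (rule nn_integral_mono_AE)
    have "AE s in lborel. s \<noteq> (0::real)" by (rule AE_lborel_singleton)
    thus "AE s in lborel. ennreal (lag_majorant A \<bar>s\<bar>) * indicator {-pi..pi} s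
        \<le> ennreal (lag_majorant A s) * indicator {0<..pi} s
          + ennreal (lag_majorant A (- s)) * indicator {0<..pi} (- s)"
      by eventually_elim (auto split: split_indicator simp: abs_if)
  qed
  also have "\<dots> = ?I + (\<integral>\<^sup>+s. ennreal (lag_majorant A (- s)) * indicator {0<..pi} (- s) \<partial>lborel)"
    by (intro nn_integral_add) measurable
  also have "(\<integral>\<^sup>+s. ennreal (lag_majorant A (- s)) * indicator {0<..pi} (- s) \<partial>lborel) = ?I"
    by (subst (2) nn_integral_real_affine[where c="-1" and t=0]) auto
  finally have "ennreal (w pi) * (\<integral>\<^sup>+s. ennreal (lag_majorant A \<bar>s - d\<bar>) * indicator {-pi..pi} (s - d) \<partial>lborel)
      \<le> ennreal (w pi) * (?I + ?I)" by (intro mult_left_mono) auto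
  also have "\<dots> = ennreal (w pi) * ?I + ennreal (w pi) * ?I" by (simp add: distrib_left)
  also have "ennreal (w pi) * ?I
      = (\<integral>\<^sup>+s. ennreal (w pi) * (ennreal (lag_majorant A s) * indicator {0<..pi} s) \<partial>lborel)"
    by (intro nn_integral_cmult[symmetric]) measurable
  also have "\<dots> \<le> (\<integral>\<^sup>+s. ennreal (2 * pi) *
         (ennreal (w s * (lag_majorant A s / s)) * indicator {0<..pi} s) \<partial>lborel)"
  proof (rule nn_integral_mono)
    fix s
    show "ennreal (w pi) * (ennreal (lag_majorant A s) * indicator {0<..pi} s)
       \<le> ennreal (2 * pi) * (ennreal (w s * (lag_majorant A s / s)) * indicator {0<..pi} s)"
    proof (cases "s \<in> {0<..pi}")
      case True
      have L0: "0 \<le> lag_majorant A s" using A by (intro lag_majorant_nonneg) auto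
      have "w pi \<le> 2 * pi * w s / s"
        using w_lin[of s] True by (simp add: field_simps)
      hence "w pi * lag_majorant A s \<le> 2 * pi * w s / s * lag_majorant A s"
        by (intro mult_right_mono L0)
      hence "w pi * lag_majorant A s \<le> 2 * pi * (w s * (lag_majorant A s / s))" by simp
      thus ?thesis using True w0 L0 by (simp add: ennreal_leI flip: ennreal_mult)
    qed simp
  qed
  also have "\<dots> = ennreal (2 * pi) *
      (\<integral>\<^sup>+s. ennreal (w s * (lag_majorant A s / s)) * indicator {0<..pi} s \<partial>lborel)"
    by (intro nn_integral_cmult) measurable
  also have "\<dots> \<le> ennreal (2 * pi) * ennreal ?B"
    by (intro mult_left_mono weighted_lag_majorant_le A) auto
  also have "ennreal (2 * pi) * ennreal ?B + ennreal (2 * pi) * ennreal ?B = ennreal (4 * pi * ?B)"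
  proof -
    have "ennreal (2 * pi) * ennreal x + ennreal (2 * pi) * ennreal x = ennreal (4 * pi * x)"
      if "0 \<le> x" for x using that by (simp flip: ennreal_mult ennreal_plus)
    thus ?thesis using B0 by blast
  qed
  finally show ?thesis by (simp add: add_mono)
qed

text \<open>
  For \<open>t \<le> \<pi> / r\<close> the zero at the origin is the nearest one. For \<open>t > \<pi> / r\<close> the factor \<open>w t / t\<close>
  is at most \<open>w pi * r / pi\<close>, and the majorants around the zeros \<open>z m\<close> are summed.
\<close>

lemma lag_kernel_integral_le:
  fixes q :: "real \<Rightarrow> real"
  assumes A: "A \<in> {0<..pi}" and r: "1 \<le> r" 
    and q1: "\<And>t. \<bar>q t\<bar> \<le> 1" and qA: "\<And>t. \<bar>q t\<bar> * \<bar>sin (real r * t / 2)\<bar> \<le> A"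
  shows "(\<integral>\<^sup>+t. ennreal (w t * (\<bar>q t\<bar> / t)) * indicator {0<..pi} t \<partial>lborel)
       \<le> ennreal ((1 + 4 * (real r)\<^sup>2) * ((c + pi) * (A * H A)))"
proof -
  let ?B = "(c + pi) * (A * H A)"
  have B0: "0 \<le> ?B" using c A H0[of A] by auto
  have r0: "0 < real r" using r by simp
  define z where "z m = 2 * pi * real m / real r" for m
  define \<phi> where "\<phi> m t = ennreal (lag_majorant A \<bar>t - z m\<bar>) * indicator {-pi..pi} (t - z m)" for m t
  have [measurable]: "\<phi> m \<in> borel_measurable borel" for m unfolding \<phi>_def by measurable
  have "(\<integral>\<^sup>+t. ennreal (w t * (\<bar>q t\<bar> / t)) * indicator {0<..pi} t \<partial>lborel)
     \<le> (\<integral>\<^sup>+t. ennreal (w t * (lag_majorant A t / t)) * indicator {0<..pi} t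
            + (\<Sum>m\<in>{1..r}. ennreal (real r / pi) * (ennreal (w pi) * \<phi> m t)) \<partial>lborel)"
  proof (rule nn_integral_mono)
    fix t
    show "ennreal (w t * (\<bar>q t\<bar> / t)) * indicator {0<..pi} t
      \<le> ennreal (w t * (lag_majorant A t / t)) * indicator {0<..pi} t
            + (\<Sum>m\<in>{1..r}. ennreal (real r / pi) * (ennreal (w pi) * \<phi> m t))"
    proof (cases "t \<in> {0<..pi}")
      case t: True
      show ?thesis
      proof (cases "t \<le> pi / real r")
        case True
        have "\<bar>q t\<bar> \<le> lag_majorant A t"
          using lag_bound_near_zero[OF r _ q1[of t] qA[of t]] A t True by simp
        hence "w t * (\<bar>q t\<bar> / t) \<le> w t * (lag_majorant A t / t)"
          using t w0 by (intro mult_left_mono divide_right_mono) auto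
        hence "ennreal (w t * (\<bar>q t\<bar> / t)) \<le> ennreal (w t * (lag_majorant A t / t))"
          by (rule ennreal_leI)
        thus ?thesis using t by (intro add_increasing2) auto
      next
        case False
        then obtain m where m: "m \<in> {1..r}" "\<bar>t - z m\<bar> \<le> pi / real r"
            "\<bar>sin (real r * (t - z m) / 2)\<bar> = \<bar>sin (real r * t / 2)\<bar>"
          unfolding z_def using nearest_zero_of_sine[OF r, of t] t by auto
        have q: "\<bar>q t\<bar> \<le> lag_majorant A \<bar>t - z m\<bar>"
          using lag_bound_near_zero[OF r m(2) q1[of t], of A] qA[of t] m(3) A by simp
        have "pi / real r \<le> pi" using r by (simp add: field_simps)
        hence ind: "t - z m \<in> {-pi..pi}" using m(2) by auto
        have "w t / t \<le> w pi / (pi / real r)"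
          using t False w0 w_mono[of t pi] r0 by (intro frac_le) auto
        hence "w t / t * \<bar>q t\<bar> \<le> w pi / (pi / real r) * lag_majorant A \<bar>t - z m\<bar>"
          using q t w0 r0 by (intro mult_mono) auto
        hence "w t * (\<bar>q t\<bar> / t) \<le> real r / pi * (w pi * lag_majorant A \<bar>t - z m\<bar>)"
          by (simp add: mult_ac)
        hence "ennreal (w t * (\<bar>q t\<bar> / t)) \<le> ennreal (real r / pi * (w pi * lag_majorant A \<bar>t - z m\<bar>))"
          by (rule ennreal_leI)
        also have "\<dots> = ennreal (real r / pi) * (ennreal (w pi) * \<phi> m t)"
        proof -
          have "0 \<le> lag_majorant A \<bar>t - z m\<bar>" using A by (intro lag_majorant_nonneg) auto
          hence "ennreal (w pi * lag_majorant A \<bar>t - z m\<bar>) = ennreal (w pi) * \<phi> m t"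
            using ind w0 by (simp add: \<phi>_def ennreal_mult)
          thus ?thesis using w0[of pi] \<open>0 \<le> lag_majorant A \<bar>t - z m\<bar>\<close>
            by (subst ennreal_mult) auto
        qed
        also have "\<dots> \<le> (\<Sum>m\<in>{1..r}. ennreal (real r / pi) * (ennreal (w pi) * \<phi> m t))"
          using m(1) by (intro member_le_sum) auto
        finally show ?thesis using t by (intro add_increasing) auto
      qed
    qed simp
  qed
  also have "\<dots> = (\<integral>\<^sup>+t. ennreal (w t * (lag_majorant A t / t)) * indicator {0<..pi} t \<partial>lborel)
      + (\<Sum>m\<in>{1..r}. ennreal (real r / pi) * (ennreal (w pi) * (\<integral>\<^sup>+t. \<phi> m t \<partial>lborel)))"
    by (subst nn_integral_add, measurable, subst nn_integral_sum, measurable)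
       (simp add: nn_integral_cmult)
  also have "\<dots> \<le> ennreal ?B + (\<Sum>m\<in>{1..r}. ennreal (real r / pi) * ennreal (4 * pi * ?B))"
    unfolding \<phi>_def
    by (intro add_mono sum_mono mult_left_mono weighted_lag_majorant_le reflected_lag_majorant_le A) auto
  also have "\<dots> = ennreal ?B + ennreal (real r * (real r / pi * (4 * pi * ?B)))"
    using B0 by (simp add: ennreal_of_nat_eq_real_of_nat flip: ennreal_mult)
  also have "\<dots> = ennreal (?B + real r * (real r / pi * (4 * pi * ?B)))"
    using B0 by (intro ennreal_plus[symmetric]) auto
  also have "?B + real r * (real r / pi * (4 * pi * ?B)) = (1 + 4 * (real r)\<^sup>2) * ?B"
    by (simp add: power2_eq_square algebra_simps)
  finally show ?thesis .
qed

end

section \<open>Conjugate operators as absolutely convergent integrals\<close>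

text \<open>
  A Borel function almost everywhere equal to \<open>f\<close> need not be periodic, so its values on \<open>[0, 2\<pi>)\<close>
  are continued periodically.
\<close>

lemma borel_periodic_representative:
  assumes per: "periodic_2pi f" and "f \<in> borel_measurable lebesgue"
  obtains g where "periodic_2pi g" "g \<in> borel_measurable borel" "AE x in lborel. f x = g x"
proof -
  obtain g0 where [measurable]: "g0 \<in> borel_measurable borel" and g0: "AE x in lborel. f x = g0 x"
    using completion_ex_borel_measurable_real[OF assms(2)] by auto
  have per': "f (x + 2 * pi) = f x" for x using per by (simp add: periodic_2pi_def)
  define g where "g x = g0 (- of_int \<lfloor>x / (2 * pi)\<rfloor> * (2 * pi) + 1 * x)" for x
  have "AE x in lborel. f (of_int m * (2 * pi) + 1 * x) = g0 (of_int m * (2 * pi) + 1 * x)" for m :: int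
    by (rule AE_lborel_affine[OF g0]) simp
  hence "AE x in lborel. \<forall>m::int. f (of_int m * (2 * pi) + 1 * x) = g0 (of_int m * (2 * pi) + 1 * x)"
    by (subst AE_all_countable) auto
  hence "AE x in lborel. f x = g x"
  proof eventually_elim
    case (elim x)
    show ?case
      using elim[rule_format, of "- \<lfloor>x / (2 * pi)\<rfloor>"]
        periodic_int_mult[of f x "- \<lfloor>x / (2 * pi)\<rfloor>", OF per']
      by (simp add: g_def algebra_simps)
  qed
  moreover have "periodic_2pi g"
  proof -
    have "\<lfloor>(x + 2 * pi) / (2 * pi)\<rfloor> = \<lfloor>x / (2 * pi)\<rfloor> + 1" for x :: real
      by (simp add: add_divide_distrib)
    thus ?thesis by (simp add: periodic_2pi_def g_def algebra_simps)
  qed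
  moreover have "g \<in> borel_measurable borel" unfolding g_def by measurable
  ultimately show ?thesis using that by blast
qed

lemma
  assumes [measurable]: "g \<in> borel_measurable borel" and AE: "AE x in lborel. f x = g x"
  shows AE_psi_eq_1: "AE x in lborel. psi f x t = psi g x t"
    and AE_psi_eq_2: "AE t in lborel. psi f x t = psi g x t"
proof -
  have 1: "AE x in lborel. f (t + 1 * x) = g (t + 1 * x)" for t
    by (rule AE_lborel_affine[OF AE]) simp
  have 2: "AE x in lborel. f (t + (-1) * x) = g (t + (-1) * x)" for t
    by (rule AE_lborel_affine[OF AE]) simp
  show "AE x in lborel. psi f x t = psi g x t"
    using 1[of t] 1[of "- t"] by eventually_elim (simp add: psi_def add.commute)
  show "AE t in lborel. psi f x t = psi g x t"
    using 1[of x] 2[of x] by eventually_elim (simp add: psi_def)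
qed

lemma set_integral_lebesgue_cong_AE:
  fixes p q :: "real \<Rightarrow> real"
  assumes [measurable]: "q \<in> borel_measurable borel" "S \<in> sets borel" and AE: "AE t in lborel. p t = q t"
  shows "(LINT t:S|lebesgue. p t) = (LINT t:S|lborel. q t)"
proof -
  have AE': "AE t in lborel. indicator S t *\<^sub>R p t = indicator S t *\<^sub>R q t"
    using AE by eventually_elim simp
  have "(LINT t:S|lebesgue. p t) = (LINT t:S|lebesgue. q t)"
    unfolding set_lebesgue_integral_def
  proof (rule integral_cong_AE)
    show "(\<lambda>t. indicator S t *\<^sub>R p t) \<in> borel_measurable lebesgue"
      by (rule borel_measurable_lebesgue_AE_eq[OF _ AE']) measurable
    show "(\<lambda>t. indicator S t *\<^sub>R q t) \<in> borel_measurable lebesgue"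
      by (rule measurable_completion) measurable
    show "AE t in lebesgue. indicator S t *\<^sub>R p t = indicator S t *\<^sub>R q t"
      by (rule AE_completion[OF AE'])
  qed
  thus ?thesis by (simp add: set_integral_lebesgue_eq_lborel)
qed

text \<open>
  The operators depend on \<open>f\<close> only through integrals, so they agree at every single point, not just
  almost everywhere. Passing to a Borel representative therefore changes none of the functions in
  question, while it makes \<open>psi\<close> jointly measurable as Tonelli's theorem requires.
\<close>

lemma conjugate_operators_cong_AE:
  assumes [measurable]: "g \<in> borel_measurable borel" and AE: "AE x in lborel. f x = g x"
  shows "conj_partial_sum k f = conj_partial_sum k g" "conj_mean a n f = conj_mean a n g"
    and "conj_trunc f x = conj_trunc g x" "conj_fun f = conj_fun g"
proof -
  have coeff: "(LINT t:{-pi..pi}|lebesgue. f t * q t) = (LINT t:{-pi..pi}|lebesgue. g t * q t)"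
    if [measurable]: "q \<in> borel_measurable borel" for q
  proof -
    have "AE t in lborel. f t * q t = g t * q t" using AE by eventually_elim simp
    from set_integral_lebesgue_cong_AE[OF _ _ this]
    show ?thesis by (simp add: set_integral_lebesgue_eq_lborel)
  qed
  have "fourier_a f \<nu> = fourier_a g \<nu>" "fourier_b f \<nu> = fourier_b g \<nu>" for \<nu>
    by (simp_all add: fourier_a_def fourier_b_def coeff)
  thus S: "conj_partial_sum k f = conj_partial_sum k g" for k
    by (simp add: fun_eq_iff conj_partial_sum_def)
  show "conj_mean a n f = conj_mean a n g" by (simp add: fun_eq_iff conj_mean_def S)
  show T: "conj_trunc f x = conj_trunc g x" for x
  proof
    fix \<epsilon>
    have "AE t in lborel. psi f x t * (1 / 2 * cot (t / 2)) = psi g x t * (1 / 2 * cot (t / 2))"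
      using AE_psi_eq_2[OF assms, of x] by eventually_elim simp
    from set_integral_lebesgue_cong_AE[OF _ _ this, of "{\<epsilon>..pi}"]
    show "conj_trunc f x \<epsilon> = conj_trunc g x \<epsilon>"
      by (simp add: conj_trunc_def set_integral_lebesgue_eq_lborel cot_def)
  qed
  show "conj_fun f = conj_fun g" by (simp add: fun_eq_iff conj_fun_def T)
qed

lemma norm_Lp_cong_AE:
  assumes F: "F \<in> borel_measurable lebesgue" and G: "G \<in> borel_measurable lebesgue"
    and AE: "AE x in lborel. F x = G x"
  shows "norm_of (Lp p) F = norm_of (Lp p) G"
    and "periodic_2pi F \<Longrightarrow> periodic_2pi G \<Longrightarrow> F \<in> carrier_of (Lp p) \<longleftrightarrow> G \<in> carrier_of (Lp p)"
proof -
  have "ess_bound F = ess_bound G"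
    unfolding ess_bound_def
  proof (rule esssup_AE_cong)
    show "(\<lambda>t. ereal \<bar>F t\<bar>) \<in> borel_measurable (restrict_space lebesgue {-pi..pi})"
      "(\<lambda>t. ereal \<bar>G t\<bar>) \<in> borel_measurable (restrict_space lebesgue {-pi..pi})"
      using F G by (auto intro!: measurable_restrict_space1)
    show "AE x in restrict_space lebesgue {-pi..pi}. ereal \<bar>F x\<bar> = ereal \<bar>G x\<bar>"
      unfolding AE_lebesgue_on_period_iff using AE by eventually_elim simp
  qed
  moreover have AE': "AE t in lebesgue. t \<in> {-pi..pi} \<longrightarrow> \<bar>F t\<bar> powr s = \<bar>G t\<bar> powr s" for s
    using AE_completion[OF AE] by eventually_elim simp
  have m: "(\<lambda>t. \<bar>F t\<bar> powr s) \<in> borel_measurable lebesgue" "(\<lambda>t. \<bar>G t\<bar> powr s) \<in> borel_measurable lebesgue"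
    for s using F G by measurable
  have S: "{-pi..pi} \<in> sets lebesgue" by simp
  have "(LINT t:{-pi..pi}|lebesgue. \<bar>F t\<bar> powr s) = (LINT t:{-pi..pi}|lebesgue. \<bar>G t\<bar> powr s)"
    and "set_integrable lebesgue {-pi..pi} (\<lambda>t. \<bar>F t\<bar> powr s) \<longleftrightarrow>
         set_integrable lebesgue {-pi..pi} (\<lambda>t. \<bar>G t\<bar> powr s)" for s
    by (rule set_lebesgue_integral_cong_AE[OF S m AE']) (rule set_integrable_cong_AE[OF m AE' S])
  ultimately show "norm_of (Lp p) F = norm_of (Lp p) G"
    and "periodic_2pi F \<Longrightarrow> periodic_2pi G \<Longrightarrow> F \<in> carrier_of (Lp p) \<longleftrightarrow> G \<in> carrier_of (Lp p)"
    using F G by auto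
qed

lemma modulus_class_borel_representative:
  assumes f: "f \<in> modulus_class X \<omega>"
  obtains g where "g \<in> modulus_class X \<omega>" "g \<in> borel_measurable borel" "AE x in lborel. f x = g x"
proof (cases X)
  case Cont
  have "f \<in> borel_measurable borel"
    using f Cont by (auto simp: modulus_class_def intro: borel_measurable_continuous_onI)
  thus ?thesis using f by (intro that[of f]) auto
next
  case (Lp p)
  have fX: "f \<in> carrier_of (Lp p)" using f Lp by (simp add: modulus_class_def del: carrier_of.simps)
  hence per: "periodic_2pi f" and fm: "f \<in> borel_measurable lebesgue" by auto
  obtain g where g: "periodic_2pi g" and gm [measurable]: "g \<in> borel_measurable borel"
      and AE: "AE x in lborel. f x = g x"
    by (rule borel_periodic_representative[OF per fm])
  have gl: "g \<in> borel_measurable lebesgue" by (rule measurable_completion) measurable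
  have psi_g: "(\<lambda>x. psi g x t) \<in> borel_measurable lebesgue" for t
    by (rule measurable_completion) measurable
  have psi_f: "(\<lambda>x. psi f x t) \<in> borel_measurable lebesgue" for t
    by (rule borel_measurable_lebesgue_AE_eq[OF _ AE_psi_eq_1[OF gm AE]]) measurable
  have "norm_of X (\<lambda>x. psi f x t) = norm_of X (\<lambda>x. psi g x t)" for t
    unfolding Lp by (rule norm_Lp_cong_AE[OF psi_f psi_g AE_psi_eq_1[OF gm AE]])
  hence "conj_modulus2 X f = conj_modulus2 X g" by (simp add: fun_eq_iff conj_modulus2_def)
  moreover have "g \<in> carrier_of X"
    using norm_Lp_cong_AE(2)[OF fm gl AE per g] fX Lp by blast
  ultimately show ?thesis using f by (intro that[OF _ gm AE]) (simp add: modulus_class_def)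
qed

lemma modulus_class_psi_bound:
  assumes X: "valid_space X" and om: "modulus_type \<omega>" and g: "g \<in> modulus_class X \<omega>"
    and [measurable]: "g \<in> borel_measurable borel"
  obtains C where "0 < C" "\<And>t. t \<in> {0<..pi} \<Longrightarrow> norm_of X (\<lambda>x. psi g x t) \<le> C * \<omega> t"
proof -
  have gX: "g \<in> carrier_of X" using g by (simp add: modulus_class_def)
  obtain B where "\<And>t. (\<lambda>x. psi g x t) \<in> carrier_of X"
      and B: "\<And>t. norm_of X (\<lambda>x. psi g x t) \<le> B"
    using psi_bounded_in_space[OF X gX assms(4)] by blast
  have "(\<lambda>\<delta>. conj_modulus2 X g \<delta>) \<in> O[principal {0..2*pi}](\<omega>)"
    using g by (simp add: modulus_class_def)
  then obtain C where C: "0 < C" "\<And>\<delta>. \<delta> \<in> {0..2*pi} \<Longrightarrow> norm (conj_modulus2 X g \<delta>) \<le> C * norm (\<omega> \<delta>)"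
    by (auto simp: bigo_def eventually_principal)
  have "norm_of X (\<lambda>x. psi g x t) \<le> C * \<omega> t" if t: "t \<in> {0<..pi}" for t
  proof -
    have "bdd_above ((\<lambda>t. norm_of X (\<lambda>x. psi g x t)) ` {0<..t})"
      by (rule bdd_aboveI2) (rule B)
    hence "norm_of X (\<lambda>x. psi g x t) \<le> conj_modulus2 X g t"
      using t unfolding conj_modulus2_def by (auto intro!: cSUP_upper)
    also have "\<dots> \<le> C * norm (\<omega> t)" using C(2)[of t] t by auto
    finally show ?thesis using modulus_type_nonneg[OF om, of t] t by simp
  qed
  with C(1) show ?thesis by (rule that)
qed

lemma carrier_integrable_on_period:
  assumes X: "valid_space X" and g: "g \<in> carrier_of X" and [measurable]: "g \<in> borel_measurable borel"
  shows "set_integrable lborel {-pi..pi} g"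
proof (cases X)
  case Cont
  hence "continuous_on {-pi..pi} g" using g by (auto intro: continuous_on_subset)
  thus ?thesis unfolding set_integrable_def by (intro borel_integrable_compact) auto
next
  case (Lp p)
  have const: "set_integrable lborel {-pi..pi} (\<lambda>x. M)" for M :: real
    unfolding set_integrable_def by (intro borel_integrable_compact) auto
  have meas: "set_borel_measurable lborel {-pi..pi} g"
    unfolding set_borel_measurable_def by measurable
  show ?thesis
  proof (cases "p = \<infinity>")
    case True
    have "AE x in lborel. x \<in> {-pi..pi} \<longrightarrow> norm (g x) \<le> norm (norm_of X g)"
      using AE_le_norm_Linf[of g] g Lp True
      by (auto elim!: eventually_mono simp del: norm_of.simps carrier_of.simps)
    thus ?thesis by (rule set_integrable_bound[OF const meas])
  next
    case False
    define q where "q = enn2real p"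
    have q1: "1 \<le> q" using enn2real_ge_1[of p] X Lp False by (simp add: q_def)
    have "set_integrable lebesgue {-pi..pi} (\<lambda>t. \<bar>g t\<bar> powr q)"
      using g Lp False by (simp add: q_def)
    hence "set_integrable lborel {-pi..pi} (\<lambda>t. \<bar>g t\<bar> powr q)"
      unfolding set_integrable_def by (subst (asm) integrable_completion) measurable
    hence "set_integrable lborel {-pi..pi} (\<lambda>t. 1 + \<bar>g t\<bar> powr q)"
      by (intro set_integral_add const)
    moreover have "\<bar>g x\<bar> \<le> 1 + \<bar>g x\<bar> powr q" for x
    proof (cases "\<bar>g x\<bar> \<le> 1")
      case False
      hence "\<bar>g x\<bar> powr 1 \<le> \<bar>g x\<bar> powr q" using q1 by (intro powr_mono) auto
      with False show ?thesis by simp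
    qed (auto intro: add_increasing2)
    hence "AE x in lborel. x \<in> {-pi..pi} \<longrightarrow> norm (g x) \<le> norm (1 + \<bar>g x\<bar> powr q)" by simp
    ultimately show ?thesis by (rule set_integrable_bound[OF _ meas])
  qed
qed

lemma periodic_conj_partial_sum: "periodic_2pi (conj_partial_sum k g)"
proof -
  have "sin (real \<nu> * (x + 2 * pi)) = sin (real \<nu> * x)" "cos (real \<nu> * (x + 2 * pi)) = cos (real \<nu> * x)" for \<nu> x
    using sin_int_2pin[of "int \<nu>"] cos_int_2pin[of "int \<nu>"]
    by (simp_all add: distrib_left sin_add cos_add mult_ac)
  thus ?thesis by (simp add: periodic_2pi_def conj_partial_sum_def)
qed

lemma
  assumes "periodic_2pi g"
  shows periodic_conj_mean: "periodic_2pi (conj_mean a n g)"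
    and periodic_conj_trunc: "periodic_2pi (\<lambda>x. conj_trunc g x \<epsilon>)"
    and periodic_conj_fun: "periodic_2pi (conj_fun g)"
  using periodic_conj_partial_sum[of _ g] psi_periodic[OF assms]
  by (simp_all add: periodic_2pi_def conj_mean_def conj_trunc_def conj_fun_def)

lemma periodic_diff: "periodic_2pi F \<Longrightarrow> periodic_2pi G \<Longrightarrow> periodic_2pi (\<lambda>x. F x - G x)"
  by (simp add: periodic_2pi_def)

text \<open>
  In this context \<open>x\<close> is a point at which \<open>psi g x t / t\<close> is absolutely integrable. All kernels in
  use are \<open>O(1 / t)\<close>, so at such a point every integral converges absolutely.
\<close>

context
  fixes g :: "real \<Rightarrow> real" and x :: real
  assumes g [measurable]: "g \<in> borel_measurable borel"
    and dini: "set_integrable lborel {0<..pi} (\<lambda>t. psi g x t * (1 / t))"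
begin

lemma integrable_psi_kernel:
  assumes [measurable]: "k \<in> borel_measurable borel" "S \<in> sets borel"
    and "S \<subseteq> {0<..pi}" "\<And>t. t \<in> S \<Longrightarrow> \<bar>k t\<bar> \<le> B * (1 / t)"
  shows "set_integrable lborel S (\<lambda>t. psi g x t * k t)"
proof (rule set_integrable_bound)
  show "set_integrable lborel S (\<lambda>t. B * (psi g x t * (1 / t)))"
    by (intro set_integrable_mult_right set_integrable_subset[OF dini] impI) (use assms in auto)
  show "set_borel_measurable lborel S (\<lambda>t. psi g x t * k t)"
    unfolding set_borel_measurable_def by measurable
  have "norm (psi g x t * k t) \<le> norm (B * (psi g x t * (1 / t)))" if "t \<in> S" for t
  proof -
    have t: "0 < t" using that assms(3) by auto
    have "\<bar>psi g x t\<bar> * \<bar>k t\<bar> \<le> \<bar>psi g x t\<bar> * (\<bar>B\<bar> * (1 / t))"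
      using assms(4)[OF that] t abs_ge_self[of B]
      by (intro mult_left_mono order_trans[OF assms(4)[OF that]] mult_right_mono) auto
    thus ?thesis using t by (simp add: abs_mult mult_ac)
  qed
  thus "AE t in lborel. t \<in> S \<longrightarrow> norm (psi g x t * k t) \<le> norm (B * (psi g x t * (1 / t)))"
    by auto
qed

lemma integrable_psi_cot: "set_integrable lborel {0<..pi} (\<lambda>t. psi g x t * (1 / 2 * cot (t / 2)))"
  by (rule integrable_psi_kernel[OF _ _ subset_refl abs_half_cot_le]) measurable

lemma conj_trunc_eq:
  "conj_trunc g x \<epsilon> = - (1 / pi) * (LINT t:{\<epsilon>..pi}|lborel. psi g x t * (1 / 2 * cot (t / 2)))"
  unfolding conj_trunc_def by (subst set_integral_lebesgue_eq_lborel) auto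

lemma conj_trunc_tendsto:
  "(conj_trunc g x \<longlongrightarrow> - (1 / pi) * (LINT t:{0<..pi}|lborel. psi g x t * (1 / 2 * cot (t / 2)))) (at_right 0)"
  unfolding conj_trunc_eq[abs_def]
  by (intro tendsto_intros tendsto_set_lebesgue_integral_at_right integrable_psi_cot) auto

lemma conj_fun_eq:
  "conj_fun g x = - (1 / pi) * (LINT t:{0<..pi}|lborel. psi g x t * (1 / 2 * cot (t / 2)))"
  unfolding conj_fun_def by (rule tendsto_Lim[OF _ conj_trunc_tendsto]) simp

text \<open>
  The conjugate Dirichlet kernels are bounded by \<open>pi / t\<close> uniformly in \<open>k\<close>, so the sum over \<open>k\<close> may be
  taken under the integral. The weights have sum 1, so the cotangent keeps the coefficient 1.
\<close>

lemma conj_mean_sums: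
  assumes per: "periodic_2pi g" and int: "set_integrable lborel {-pi..pi} g"
    and b0: "\<And>k. 0 \<le> b k" and b1: "b sums 1"
  shows "(\<lambda>k. b k * conj_partial_sum k g x) sums
     (- (1 / pi) * (LINT t:{0<..pi}|lborel. psi g x t *
        (1 / 2 * cot (t / 2) - cosine_mean b t / (2 * sin (t / 2)))))"
proof -
  define D where "D k t = (\<Sum>\<nu>=1..k. sin (real \<nu> * t))" for k :: nat and t :: real
  define h where "h k t = indicator {0<..pi} t *\<^sub>R (psi g x t * (b k * D k t))" for k t
  define M where "M t = indicator {0<..pi} t *\<^sub>R \<bar>psi g x t * (1 / t)\<bar>" for t
  have [measurable]: "D k \<in> borel_measurable borel" for k unfolding D_def by measurable
  have D: "D k t = 1 / 2 * cot (t / 2) - cos ((real k + 1 / 2) * t) / (2 * sin (t / 2))"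
    if "t \<in> {0<..pi}" for k t
    unfolding D_def using sin_half_pos[OF that] by (intro conjugate_Dirichlet_kernel) simp
  have D_le: "\<bar>D k t\<bar> \<le> pi * (1 / t)" if t: "t \<in> {0<..pi}" for k t
  proof -
    have "D k t = (cos (t / 2) - cos ((real k + 1 / 2) * t)) / (2 * sin (t / 2))"
      unfolding D[OF t] by (simp add: cot_def diff_divide_distrib)
    also have "\<bar>\<dots>\<bar> \<le> pi / 2 * (\<bar>cos (t / 2) - cos ((real k + 1 / 2) * t)\<bar> / t)"
      by (rule abs_cos_quotient_le[OF t])
    also have "\<dots> \<le> pi / 2 * (2 / t)"
    proof (intro mult_left_mono divide_right_mono)
      show "\<bar>cos (t / 2) - cos ((real k + 1 / 2) * t)\<bar> \<le> 2"
        using abs_cos_le_one[of "t / 2"] abs_cos_le_one[of "(real k + 1 / 2) * t"] by linarith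
    qed (use t in auto)
    finally show ?thesis by simp
  qed
  have intD: "set_integrable lborel {0<..pi} (\<lambda>t. psi g x t * D k t)" for k
    by (rule integrable_psi_kernel[OF _ _ subset_refl D_le]) measurable
  have h_eq: "h k t = b k * (indicator {0<..pi} t *\<^sub>R (psi g x t * D k t))" for k t
    by (simp add: h_def mult_ac)
  have inth: "integrable lborel (h k)" for k
    unfolding h_eq using intD unfolding set_integrable_def by (intro integrable_mult_right)
  have intM: "integrable lborel M"
    using integrable_norm[OF dini[unfolded set_integrable_def]] by (simp add: M_def[abs_def] abs_mult)
  have h_le: "norm (h k t) \<le> b k * pi * M t" for k t
  proof (cases "t \<in> {0<..pi}")
    case True
    have "\<bar>psi g x t\<bar> * (b k * \<bar>D k t\<bar>) \<le> \<bar>psi g x t\<bar> * (b k * (pi * (1 / t)))"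
      by (intro mult_left_mono D_le True b0) auto
    thus ?thesis using True b0[of k] by (simp add: h_def M_def abs_mult mult_ac)
  qed (simp add: h_def M_def)
  have sumM: "summable (\<lambda>k. b k * pi * M t)" for t
    using b1 by (intro summable_mult2) (auto simp: sums_iff)
  have "(\<lambda>k. integral\<^sup>L lborel (h k)) sums (LINT t|lborel. (\<Sum>k. h k t))"
  proof (rule sums_integral[OF inth])
    have "summable (\<lambda>k. norm (h k t))" for t
      by (rule summable_comparison_test'[OF sumM[of t]]) (use h_le in simp)
    thus "AE t in lborel. summable (\<lambda>k. norm (h k t))" by simp
    show "summable (\<lambda>k. LINT t|lborel. norm (h k t))"
    proof (rule summable_comparison_test')
      show "summable (\<lambda>k. b k * (pi * integral\<^sup>L lborel M))"
        using b1 by (intro summable_mult2) (auto simp: sums_iff)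
      have "(LINT t|lborel. norm (h k t)) \<le> (LINT t|lborel. b k * pi * M t)" for k
        using h_le inth intM by (intro integral_mono integrable_norm integrable_mult_right) auto
      thus "norm (LINT t|lborel. norm (h k t)) \<le> b k * (pi * integral\<^sup>L lborel M)" for k
        by (simp add: mult_ac)
    qed
  qed
  moreover have "integral\<^sup>L lborel (h k) = b k * (- pi * conj_partial_sum k g x)" for k
    unfolding h_eq conj_partial_sum_eq_integral[OF per g int]
    by (simp add: set_lebesgue_integral_def D_def)
  moreover have "(\<Sum>k. h k t) = indicator {0<..pi} t *\<^sub>R (psi g x t *
        (1 / 2 * cot (t / 2) - cosine_mean b t / (2 * sin (t / 2))))" for t
  proof (cases "t \<in> {0<..pi}")
    case True
    have "(\<lambda>k. b k * cos ((real k + 1 / 2) * t)) sums cosine_mean b t"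
      unfolding cosine_mean_def
      by (intro summable_sums summable_trig(1)[where r=1] b0 b1) auto
    hence "(\<lambda>k. psi g x t * (b k * (1 / 2 * cot (t / 2)) -
               b k * cos ((real k + 1 / 2) * t) / (2 * sin (t / 2)))) sums
         (psi g x t * (1 * (1 / 2 * cot (t / 2)) - cosine_mean b t / (2 * sin (t / 2))))"
      by (intro sums_mult sums_diff sums_mult2[OF b1] sums_divide)
    moreover have "h k t = psi g x t * (b k * (1 / 2 * cot (t / 2)) -
               b k * cos ((real k + 1 / 2) * t) / (2 * sin (t / 2)))" for k
      using True by (simp add: h_def D right_diff_distrib)
    ultimately show ?thesis using True by (simp add: sums_iff)
  qed (simp add: h_def)
  ultimately have "(\<lambda>k. b k * (- pi * conj_partial_sum k g x)) sums
     (LINT t:{0<..pi}|lborel. psi g x t * (1 / 2 * cot (t / 2) - cosine_mean b t / (2 * sin (t / 2))))"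
    unfolding set_lebesgue_integral_def by simp
  from sums_mult[OF this, of "- (1 / pi)"] show ?thesis by (simp add: mult_ac)
qed

end

section \<open>The approximation theorem\<close>

lemma norm_of_nonneg:
  assumes F: "F \<in> carrier_of X"
  shows "0 \<le> norm_of X F"
proof (cases X)
  case Cont
  thus ?thesis using abs_le_norm_Cont[of F 0] F by simp
next
  case (Lp p)
  show ?thesis
  proof (cases "p = \<infinity>")
    case True
    show ?thesis
    proof (rule ccontr)
      assume neg: "\<not> 0 \<le> norm_of X F"
      have "AE x in lborel. x \<in> {-pi..pi} \<longrightarrow> \<bar>F x\<bar> \<le> norm_of X F"
        using AE_le_norm_Linf[of F] F unfolding Lp True by blast
      hence "AE x in lborel. x \<notin> {-pi..pi}"
        by eventually_elim (use neg in \<open>auto simp del: norm_of.simps\<close>)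
      hence "emeasure lborel {-pi..pi} = 0"
        by (subst (asm) AE_iff_measurable[where N="{-pi..pi}"]) auto
      thus False by simp
    qed
  qed (simp add: Lp)
qed

text \<open>
  Both differences are integrals of \<open>psi\<close> against a kernel: \<open>Q / pi\<close> for the conjugate function, and
  for the truncation at \<open>A / r\<close> the same kernel minus \<open>cot (t / 2) / (2 * pi)\<close> on \<open>(0, A / r)\<close>. As
  \<open>A / r \<le> A\<close>, the additional part costs at most the integral of \<open>w t / t\<close> over \<open>(0, A]\<close>; this is the
  last summand of \<open>K\<close>.
\<close>

lemma conjugate_mean_approximation:
  fixes X :: fun_space and w H g :: "real \<Rightarrow> real" and a :: "nat \<Rightarrow> nat \<Rightarrow> real" and r :: nat
  assumes X: "valid_space X" and gX: "g \<in> carrier_of X" and g [measurable]: "g \<in> borel_measurable borel"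
    and w [measurable]: "w \<in> borel_measurable borel" and w0: "\<And>t. 0 \<le> w t"
    and w_mono: "\<And>s t. 0 < s \<Longrightarrow> s \<le> t \<Longrightarrow> t \<le> pi \<Longrightarrow> w s \<le> w t"
    and w_lin: "\<And>t. 0 < t \<Longrightarrow> t \<le> pi \<Longrightarrow> w pi * t \<le> 2 * pi * w t"
    and psi: "\<And>t. t \<in> {0<..pi} \<Longrightarrow> norm_of X (\<lambda>x. psi g x t) \<le> w t"
    and H0: "\<And>u. u \<in> {0<..pi} \<Longrightarrow> 0 \<le> H u" and c: "0 \<le> c"
    and tail: "\<And>u. u \<in> {0<..pi} \<Longrightarrow>
      (\<integral>\<^sup>+t. ennreal (w t / t\<^sup>2) * indicator {u..pi} t \<partial>lborel) \<le> ennreal (H u)"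
    and prim: "\<And>u. u \<in> {0<..pi} \<Longrightarrow>
      (\<integral>\<^sup>+t. ennreal (H t) * indicator {0<..u} t \<partial>lebesgue) \<le> ennreal (c * (u * H u))"
    and r: "1 \<le> r" and a0: "\<And>n k. 0 \<le> a n k" and a1: "\<And>n. a n sums 1"
  defines "A \<equiv> \<lambda>n. row_variation a n r"
    and "K \<equiv> (1 + 4 * (real r)\<^sup>2) * (c + pi) + c"
  shows "holds_in X (\<lambda>x. \<exists>L. ((\<lambda>\<epsilon>. conj_trunc g x \<epsilon>) \<longlongrightarrow> L) (at_right 0))"
    and "holds_in X (\<lambda>x. summable (\<lambda>k. a n k * conj_partial_sum k g x))"
    and "(\<lambda>x. conj_mean a n g x - conj_fun g x) \<in> carrier_of X
       \<and> norm_of X (\<lambda>x. conj_mean a n g x - conj_fun g x) \<le> K * (A n * H (A n))"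
    and "(\<lambda>x. conj_mean a n g x - conj_trunc g x (1 / real r * A n)) \<in> carrier_of X
       \<and> norm_of X (\<lambda>x. conj_mean a n g x - conj_trunc g x (1 / real r * A n)) \<le> K * (A n * H (A n))"
proof -
  have per: "periodic_2pi g" using gX by (cases X) auto
  have int: "set_integrable lborel {-pi..pi} g" by (rule carrier_integrable_on_period[OF X gX g])
  have row: "A n = (\<Sum>k. \<bar>a n k - a n (k + r)\<bar>)" by (simp add: A_def row_variation_def)
  note row_facts = a0[of n] a1[of n] r row
  have A0: "0 < A n" by (rule lag_variation_pos[OF row_facts])
  have A: "A n \<in> {0<..pi}" using A0 lag_variation_le_2[OF row_facts] pi_ge_two by auto
  have HA: "0 \<le> A n * H (A n)" using A H0[OF A] by auto
  note dini_le = dini_integral_le[OF w w0 w_mono w_lin H0 c tail prim]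
  define q where "q = cosine_mean (a n)"
  define Q where "Q t = q t / (2 * sin (t / 2))" for t
  define T where "T t = 1 / 2 * cot (t / 2)" for t :: real
  define \<epsilon> where "\<epsilon> = 1 / real r * A n"
  have \<epsilon>: "0 < \<epsilon>" "\<epsilon> \<le> A n" using A0 r by (auto simp: \<epsilon>_def field_simps mult_le_cancel_left1)
  have [measurable]: "q \<in> borel_measurable borel" "Q \<in> borel_measurable borel"
    "T \<in> borel_measurable borel"
    unfolding q_def Q_def[abs_def] T_def[abs_def] cot_def by measurable
  have q1: "\<bar>q t\<bar> \<le> 1" for t
    unfolding q_def by (rule abs_cosine_mean_le_1[OF row_facts])
  have qA: "\<bar>q t\<bar> * \<bar>sin (real r * t / 2)\<bar> \<le> A n" for t
    unfolding q_def by (rule abs_cosine_mean_sin_le[OF row_facts])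
  have Q_le: "\<bar>Q t / pi\<bar> \<le> \<bar>q t\<bar> / t" if "t \<in> {0<..pi}" for t
  proof -
    have "\<bar>Q t\<bar> \<le> pi / 2 * (\<bar>q t\<bar> / t)" unfolding Q_def by (rule abs_cos_quotient_le[OF that])
    also have "\<dots> \<le> pi * (\<bar>q t\<bar> / t)" using that by (intro mult_right_mono) auto
    finally show ?thesis by (simp add: abs_divide field_simps)
  qed
  have T_le: "\<bar>T t\<bar> \<le> pi / 2 * (1 / t)" if "t \<in> {0<..pi}" for t
    unfolding T_def by (rule abs_half_cot_le[OF that])
  have q_int: "(\<integral>\<^sup>+t. ennreal (w t * (\<bar>q t\<bar> / t)) * indicator {0<..pi} t \<partial>lborel)
      \<le> ennreal ((1 + 4 * (real r)\<^sup>2) * ((c + pi) * (A n * H (A n))))"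
    by (rule lag_kernel_integral_le[OF w w0 w_mono w_lin H0 c tail prim A r q1 qA]) measurable

  \<comment> \<open>the points at which every integral below converges absolutely\<close>
  have good: "holds_in X (\<lambda>x. set_integrable lborel {0<..pi} (\<lambda>t. psi g x t * (1 / t)))"
  proof (rule kernel_operator(1)[OF X gX g _ w w0 psi])
    show "0 \<le> c * (pi * H pi)" using c H0[of pi] by simp
    have "(\<integral>\<^sup>+t. ennreal (w t * \<bar>1 / t\<bar>) * indicator {0<..pi} t \<partial>lborel)
        = (\<integral>\<^sup>+t. ennreal (w t / t) * indicator {0<..pi} t \<partial>lborel)"
      by (intro nn_integral_cong) (auto split: split_indicator)
    also have "\<dots> \<le> ennreal (c * (pi * H pi))" by (intro dini_le) auto
    finally show "(\<integral>\<^sup>+t. ennreal (w t * \<bar>1 / t\<bar>) * indicator {0<..pi} t \<partial>lborel)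
        \<le> ennreal (c * (pi * H pi))" .
  qed measurable
  note mean_sums = conj_mean_sums[OF g _ per int a0[of n] a1[of n]]
  show "holds_in X (\<lambda>x. \<exists>L. ((\<lambda>\<epsilon>. conj_trunc g x \<epsilon>) \<longlongrightarrow> L) (at_right 0))"
    by (rule holds_in_mono[OF good]) (use conj_trunc_tendsto[OF g] in blast)
  show "holds_in X (\<lambda>x. summable (\<lambda>k. a n k * conj_partial_sum k g x))"
    by (rule holds_in_mono[OF good]) (use mean_sums in \<open>blast intro: sums_summable\<close>)

  have diff: "conj_mean a n g x - conj_fun g x = (LINT t:{0<..pi}|lborel. psi g x t * (Q t / pi))
     \<and> conj_mean a n g x - conj_trunc g x \<epsilon>
         = (LINT t:{0<..pi}|lborel. psi g x t * ((Q t - indicator {0<..<\<epsilon>} t * T t) / pi))"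
    if x: "set_integrable lborel {0<..pi} (\<lambda>t. psi g x t * (1 / t))" for x
  proof -
    note ker = integrable_psi_kernel[OF g x]
    have iQ: "set_integrable lborel {0<..pi} (\<lambda>t. psi g x t * Q t)"
    proof (rule ker[where B=pi])
      fix t assume t: "t \<in> {0<..pi}"
      have "\<bar>Q t / pi\<bar> \<le> 1 / t"
        using t q1[of t] by (intro order_trans[OF Q_le[OF t]] divide_right_mono) auto
      thus "\<bar>Q t\<bar> \<le> pi * (1 / t)" by (simp add: abs_divide field_simps)
    qed auto
    have iT: "set_integrable lborel {0<..pi} (\<lambda>t. psi g x t * T t)"
      by (rule ker[OF _ _ subset_refl T_le]) measurable
    have iT1: "set_integrable lborel {0<..<\<epsilon>} (\<lambda>t. psi g x t * T t)"
      by (rule set_integrable_subset[OF iT]) (use A \<epsilon> in auto)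
    have iT2: "set_integrable lborel {\<epsilon>..pi} (\<lambda>t. psi g x t * T t)"
      by (rule set_integrable_subset[OF iT]) (use A \<epsilon> in auto)
    have mean: "conj_mean a n g x
        = - (1 / pi) * (LINT t:{0<..pi}|lborel. psi g x t * T t - psi g x t * Q t)"
      using mean_sums[OF x]
      by (simp add: conj_mean_def sums_iff T_def Q_def q_def right_diff_distrib)
    also have "\<dots> = - (1 / pi) * ((LINT t:{0<..pi}|lborel. psi g x t * T t)
                         - (LINT t:{0<..pi}|lborel. psi g x t * Q t))"
      by (subst set_integral_diff(2)[OF iT iQ]) simp
    finally have mean: "conj_mean a n g x = - (1 / pi) * ((LINT t:{0<..pi}|lborel. psi g x t * T t)
                         - (LINT t:{0<..pi}|lborel. psi g x t * Q t))" .
    have "{0<..<\<epsilon>} \<union> {\<epsilon>..pi} = {0<..pi}" "{0<..<\<epsilon>} \<inter> {\<epsilon>..pi} = {}" using A \<epsilon> by auto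
    hence split: "(LINT t:{0<..pi}|lborel. psi g x t * T t)
      = (LINT t:{0<..<\<epsilon>}|lborel. psi g x t * T t) + (LINT t:{\<epsilon>..pi}|lborel. psi g x t * T t)"
      using set_integral_Un[OF _ iT1 iT2] by simp
    have "conj_mean a n g x - conj_fun g x = 1 / pi * (LINT t:{0<..pi}|lborel. psi g x t * Q t)"
      unfolding mean conj_fun_eq[OF g x] T_def[symmetric] by (simp add: algebra_simps)
    hence 1: "conj_mean a n g x - conj_fun g x = (LINT t:{0<..pi}|lborel. psi g x t * (Q t / pi))"
      by simp
    have "conj_mean a n g x - conj_trunc g x \<epsilon>
       = 1 / pi * ((LINT t:{0<..pi}|lborel. psi g x t * Q t) - (LINT t:{0<..<\<epsilon>}|lborel. psi g x t * T t))"
      unfolding mean conj_trunc_eq[OF g x] T_def[symmetric] split by (simp add: algebra_simps)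
    also have "(LINT t:{0<..<\<epsilon>}|lborel. psi g x t * T t)
        = (LINT t:{0<..pi}|lborel. psi g x t * (indicator {0<..<\<epsilon>} t * T t))"
      unfolding set_lebesgue_integral_def using A \<epsilon>
      by (intro Bochner_Integration.integral_cong) (auto split: split_indicator)
    also have "(LINT t:{0<..pi}|lborel. psi g x t * Q t) - \<dots>
        = (LINT t:{0<..pi}|lborel. psi g x t * Q t - psi g x t * (indicator {0<..<\<epsilon>} t * T t))"
    proof (rule set_integral_diff(2)[OF iQ, symmetric])
      show "set_integrable lborel {0<..pi} (\<lambda>t. psi g x t * (indicator {0<..<\<epsilon>} t * T t))"
      proof (rule ker[where B="pi / 2"])
        fix t assume t: "t \<in> {0<..pi}"
        show "\<bar>indicator {0<..<\<epsilon>} t * T t\<bar> \<le> pi / 2 * (1 / t)"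
          using T_le[OF t] t by (auto split: split_indicator)
      qed auto
    qed
    also have "1 / pi * \<dots> = (LINT t:{0<..pi}|lborel.
        1 / pi * (psi g x t * Q t - psi g x t * (indicator {0<..<\<epsilon>} t * T t)))"
      by simp
    also have "\<dots> = (LINT t:{0<..pi}|lborel. psi g x t * ((Q t - indicator {0<..<\<epsilon>} t * T t) / pi))"
      by (simp add: right_diff_distrib diff_divide_distrib)
    finally show ?thesis using 1 by blast
  qed

  have r_sq: "0 \<le> (1 + 4 * (real r)\<^sup>2) * ((c + pi) * (A n * H (A n)))"
    using c HA by simp
  have K_eq: "K * (A n * H (A n))
      = (1 + 4 * (real r)\<^sup>2) * ((c + pi) * (A n * H (A n))) + c * (A n * H (A n))"
    by (simp add: K_def algebra_simps)
  have K0: "0 \<le> K * (A n * H (A n))" unfolding K_eq using r_sq c HA by simp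

  show "(\<lambda>x. conj_mean a n g x - conj_fun g x) \<in> carrier_of X
       \<and> norm_of X (\<lambda>x. conj_mean a n g x - conj_fun g x) \<le> K * (A n * H (A n))"
  proof (rule kernel_operator(2)[OF X gX g _ w w0 psi K0])
    show "periodic_2pi (\<lambda>x. conj_mean a n g x - conj_fun g x)"
      by (intro periodic_diff periodic_conj_mean periodic_conj_fun per)
    show "holds_in X (\<lambda>x. conj_mean a n g x - conj_fun g x
        = (LINT t:{0<..pi}|lborel. psi g x t * (Q t / pi)))"
      by (rule holds_in_mono[OF good]) (use diff in blast)
    have "(\<integral>\<^sup>+t. ennreal (w t * \<bar>Q t / pi\<bar>) * indicator {0<..pi} t \<partial>lborel)
        \<le> (\<integral>\<^sup>+t. ennreal (w t * (\<bar>q t\<bar> / t)) * indicator {0<..pi} t \<partial>lborel)"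
    proof (rule nn_integral_mono)
      fix t
      have "ennreal (w t * \<bar>Q t / pi\<bar>) \<le> ennreal (w t * (\<bar>q t\<bar> / t))" if "t \<in> {0<..pi}"
        by (intro ennreal_leI mult_left_mono Q_le w0 that)
      thus "ennreal (w t * \<bar>Q t / pi\<bar>) * indicator {0<..pi} t
          \<le> ennreal (w t * (\<bar>q t\<bar> / t)) * indicator {0<..pi} t"
        by (cases "t \<in> {0<..pi}") simp_all
    qed
    also note q_int
    also have "ennreal ((1 + 4 * (real r)\<^sup>2) * ((c + pi) * (A n * H (A n)))) \<le> ennreal (K * (A n * H (A n)))"
      unfolding K_eq using c HA by (intro ennreal_leI) simp
    finally show "(\<integral>\<^sup>+t. ennreal (w t * \<bar>Q t / pi\<bar>) * indicator {0<..pi} t \<partial>lborel)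
        \<le> ennreal (K * (A n * H (A n)))" .
  qed measurable

  show "(\<lambda>x. conj_mean a n g x - conj_trunc g x (1 / real r * A n)) \<in> carrier_of X
       \<and> norm_of X (\<lambda>x. conj_mean a n g x - conj_trunc g x (1 / real r * A n)) \<le> K * (A n * H (A n))"
    unfolding \<epsilon>_def[symmetric]
  proof (rule kernel_operator(2)[OF X gX g _ w w0 psi K0])
    show "periodic_2pi (\<lambda>x. conj_mean a n g x - conj_trunc g x \<epsilon>)"
      by (intro periodic_diff periodic_conj_mean periodic_conj_trunc per)
    show "holds_in X (\<lambda>x. conj_mean a n g x - conj_trunc g x \<epsilon>
        = (LINT t:{0<..pi}|lborel. psi g x t * ((Q t - indicator {0<..<\<epsilon>} t * T t) / pi)))"
      by (rule holds_in_mono[OF good]) (use diff in blast)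
    have "(\<integral>\<^sup>+t. ennreal (w t * \<bar>(Q t - indicator {0<..<\<epsilon>} t * T t) / pi\<bar>) * indicator {0<..pi} t \<partial>lborel)
        \<le> (\<integral>\<^sup>+t. ennreal (w t * (\<bar>q t\<bar> / t)) * indicator {0<..pi} t
              + ennreal (w t / t) * indicator {0<..A n} t \<partial>lborel)"
    proof (rule nn_integral_mono)
      fix t
      show "ennreal (w t * \<bar>(Q t - indicator {0<..<\<epsilon>} t * T t) / pi\<bar>) * indicator {0<..pi} t
          \<le> ennreal (w t * (\<bar>q t\<bar> / t)) * indicator {0<..pi} t + ennreal (w t / t) * indicator {0<..A n} t"
      proof (cases "t \<in> {0<..pi}")
        case t: True
        have "\<bar>indicator {0<..<\<epsilon>} t * T t / pi\<bar> \<le> indicator {0<..A n} t / t"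
        proof (cases "t < \<epsilon>")
          case True
          have "\<bar>T t\<bar> \<le> pi * (1 / t)"
            using t by (intro order_trans[OF T_le[OF t]] mult_right_mono) auto
          hence "\<bar>T t / pi\<bar> \<le> 1 / t" by (simp add: abs_divide field_simps)
          thus ?thesis using True t \<epsilon> by simp
        qed (use t in auto)
        hence "\<bar>(Q t - indicator {0<..<\<epsilon>} t * T t) / pi\<bar> \<le> \<bar>q t\<bar> / t + indicator {0<..A n} t / t"
          using Q_le[OF t] unfolding diff_divide_distrib by linarith
        hence "w t * \<bar>(Q t - indicator {0<..<\<epsilon>} t * T t) / pi\<bar>
             \<le> w t * (\<bar>q t\<bar> / t + indicator {0<..A n} t / t)"
          by (intro mult_left_mono w0)
        also have "\<dots> = w t * (\<bar>q t\<bar> / t) + w t / t * indicator {0<..A n} t"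
          by (simp add: distrib_left)
        finally have "ennreal (w t * \<bar>(Q t - indicator {0<..<\<epsilon>} t * T t) / pi\<bar>)
           \<le> ennreal (w t * (\<bar>q t\<bar> / t) + w t / t * indicator {0<..A n} t)"
          by (rule ennreal_leI)
        also have "\<dots> = ennreal (w t * (\<bar>q t\<bar> / t)) + ennreal (w t / t * indicator {0<..A n} t)"
          using w0 t by (intro ennreal_plus) auto
        also have "ennreal (w t / t * indicator {0<..A n} t) = ennreal (w t / t) * indicator {0<..A n} t"
          by (auto split: split_indicator)
        finally show ?thesis using t by simp
      qed simp
    qed
    also have "\<dots> = (\<integral>\<^sup>+t. ennreal (w t * (\<bar>q t\<bar> / t)) * indicator {0<..pi} t \<partial>lborel)
        + (\<integral>\<^sup>+t. ennreal (w t / t) * indicator {0<..A n} t \<partial>lborel)"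
      by (intro nn_integral_add) measurable
    also have "\<dots> \<le> ennreal ((1 + 4 * (real r)\<^sup>2) * ((c + pi) * (A n * H (A n))))
                     + ennreal (c * (A n * H (A n)))"
      by (intro add_mono q_int dini_le A)
    also have "\<dots> = ennreal (K * (A n * H (A n)))"
      unfolding K_eq using r_sq c HA by (intro ennreal_plus[symmetric]) auto
    finally show "(\<integral>\<^sup>+t. ennreal (w t * \<bar>(Q t - indicator {0<..<\<epsilon>} t * T t) / pi\<bar>) * indicator {0<..pi} t \<partial>lborel)
        \<le> ennreal (K * (A n * H (A n)))" .
  qed measurable
qed

theorem theorem2:
  fixes X :: fun_space and \<omega> H f :: "real \<Rightarrow> real"
    and a :: "nat \<Rightarrow> nat \<Rightarrow> real" and r :: nat
  assumes "valid_space X"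
    and "modulus_type \<omega>"
    and "\<And>u. u \<in> {0<..pi} \<Longrightarrow> 0 \<le> H u"
    and "(\<lambda>u. LINT t:{u..pi}|lebesgue. \<omega> t / t\<^sup>2) \<in> O[principal {0<..pi}](H)"
    and "set_integrable lebesgue {0<..pi} H"
    and "(\<lambda>u. LINT t:{0<..u}|lebesgue. H t) \<in> O[principal {0<..pi}](\<lambda>u. u * H u)"
    and "f \<in> modulus_class X \<omega>"
    and "1 \<le> r"
    and "summation_matrix a"
    and "\<And>n. (\<Sum>l=0..n. \<Sum>k=l..r+l-1. a n k) \<noteq> 0"
    and "(\<lambda>n. inverse (\<Sum>l=0..n. \<Sum>k=l..r+l-1. a n k)) \<in> O[principal UNIV](\<lambda>n. 1)"
  shows "holds_in X (\<lambda>x. \<exists>L. ((\<lambda>\<epsilon>. conj_trunc f x \<epsilon>) \<longlongrightarrow> L) (at_right 0)) \<and>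
    (\<forall>n. holds_in X (\<lambda>x. summable (\<lambda>k. a n k * conj_partial_sum k f x))) \<and>
    (\<forall>n. (\<lambda>x. conj_mean a n f x - conj_fun f x) \<in> carrier_of X) \<and>
    (\<lambda>n. norm_of X (\<lambda>x. conj_mean a n f x - conj_fun f x))
      \<in> O[principal UNIV](\<lambda>n. H (row_variation a n r) * row_variation a n r) \<and>
    (\<forall>n. (\<lambda>x. conj_mean a n f x - conj_trunc f x (1 / real r * row_variation a n r))
      \<in> carrier_of X) \<and>
    (\<lambda>n. norm_of X (\<lambda>x. conj_mean a n f x
        - conj_trunc f x (1 / real r * row_variation a n r)))
      \<in> O[principal UNIV](\<lambda>n. H (row_variation a n r) * row_variation a n r)"
proof -
  note X = assms(1) and om = assms(2) and H0 = assms(3) and Hint = assms(5) and r = assms(8)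
  obtain g where gM: "g \<in> modulus_class X \<omega>" and g [measurable]: "g \<in> borel_measurable borel"
      and fg: "AE x in lborel. f x = g x"
    by (rule modulus_class_borel_representative[OF assms(7)])
  note same = conjugate_operators_cong_AE[OF g fg]
  have gX: "g \<in> carrier_of X" using gM by (simp add: modulus_class_def)
  obtain C where C: "0 < C" "\<And>t. t \<in> {0<..pi} \<Longrightarrow> norm_of X (\<lambda>x. psi g x t) \<le> C * \<omega> t"
    using modulus_class_psi_bound[OF X om gM g] by blast
  obtain c1 where c1: "0 < c1"
      "\<And>u. u \<in> {0<..pi} \<Longrightarrow> norm (LINT t:{u..pi}|lebesgue. \<omega> t / t\<^sup>2) \<le> c1 * norm (H u)"
    using assms(4) by (auto simp: bigo_def eventually_principal)
  obtain c where c: "0 < c"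
      "\<And>u. u \<in> {0<..pi} \<Longrightarrow> norm (LINT t:{0<..u}|lebesgue. H t) \<le> c * norm (u * H u)"
    using assms(6) by (auto simp: bigo_def eventually_principal)
  have a0: "0 \<le> a n k" and a1: "a n sums 1" for n k
    using assms(9) by (auto simp: summation_matrix_def)
  define w where "w t = indicator {0..pi} t *\<^sub>R (C * \<omega> t)" for t
  \<comment> \<open>scaled such that \<open>G\<close> bounds the tail integral of \<open>w t / t\<^sup>2\<close> with constant 1\<close>
  define G where "G u = C * c1 * H u" for u
  have om_cont: "continuous_on {0..pi} \<omega>"
    using om by (auto simp: modulus_type_def intro: continuous_on_subset)
  have w [measurable]: "w \<in> borel_measurable borel"
    unfolding w_def[abs_def]
    by (intro borel_measurable_continuous_on_indicator continuous_intros om_cont) auto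
  have w0: "0 \<le> w t" for t
    using C(1) modulus_type_nonneg[OF om, of t] by (auto simp: w_def split: split_indicator)
  have w_eq: "w t = C * \<omega> t" if "0 < t" "t \<le> pi" for t using that by (simp add: w_def)
  have w_mono: "w s \<le> w t" if "0 < s" "s \<le> t" "t \<le> pi" for s t
    using that C(1) modulus_type_mono[OF om, of s t] by (simp add: w_eq)
  have w_lin: "w pi * t \<le> 2 * pi * w t" if t: "0 < t" "t \<le> pi" for t
    using mult_left_mono[OF modulus_type_linear_lower_bound[OF om t], of C] C(1) t
    by (simp add: w_eq mult_ac)
  have psi: "norm_of X (\<lambda>x. psi g x t) \<le> w t" if "t \<in> {0<..pi}" for t
    using C(2)[OF that] that by (simp add: w_eq)
  have G0: "0 \<le> G u" if "u \<in> {0<..pi}" for u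
    using H0[OF that] C(1) c1(1) by (simp add: G_def)
  have tail: "(\<integral>\<^sup>+t. ennreal (w t / t\<^sup>2) * indicator {u..pi} t \<partial>lborel) \<le> ennreal (G u)"
    if u: "u \<in> {0<..pi}" for u
  proof -
    have "continuous_on {u..pi} (\<lambda>t. \<omega> t / t\<^sup>2)"
      using u by (intro continuous_intros continuous_on_subset[OF om_cont]) auto
    hence int: "set_integrable lborel {u..pi} (\<lambda>t. \<omega> t / t\<^sup>2)"
      unfolding set_integrable_def by (intro borel_integrable_compact) auto
    have leb: "(LINT t:{u..pi}|lebesgue. \<omega> t / t\<^sup>2) = (LINT t:{u..pi}|lborel. \<omega> t / t\<^sup>2)"
      using borel_measurable_integrable[OF int[unfolded set_integrable_def]]
      unfolding set_lebesgue_integral_def by (intro integral_completion) auto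
    have "(\<integral>\<^sup>+t. ennreal (w t / t\<^sup>2) * indicator {u..pi} t \<partial>lborel)
        = (\<integral>\<^sup>+t. ennreal (C * (indicator {u..pi} t *\<^sub>R (\<omega> t / t\<^sup>2))) \<partial>lborel)"
      using u by (intro nn_integral_cong) (auto simp: w_eq split: split_indicator)
    also have "\<dots> = ennreal (LINT t|lborel. C * (indicator {u..pi} t *\<^sub>R (\<omega> t / t\<^sup>2)))"
    proof (intro nn_integral_eq_integral AE_I2)
      show "integrable lborel (\<lambda>t. C * (indicator {u..pi} t *\<^sub>R (\<omega> t / t\<^sup>2)))"
        using int unfolding set_integrable_def by (rule integrable_mult_right)
      show "0 \<le> C * (indicator {u..pi} t *\<^sub>R (\<omega> t / t\<^sup>2))" for t
        using u C(1) modulus_type_nonneg[OF om, of t] by (auto split: split_indicator)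
    qed
    also have "(LINT t|lborel. C * (indicator {u..pi} t *\<^sub>R (\<omega> t / t\<^sup>2)))
        = C * (LINT t:{u..pi}|lebesgue. \<omega> t / t\<^sup>2)"
      unfolding leb unfolding set_lebesgue_integral_def by (rule integral_mult_right_zero)
    also have "\<dots> \<le> C * (c1 * H u)"
      using c1(2)[OF u] H0[OF u] C(1) by (intro mult_left_mono) auto
    hence "ennreal (C * (LINT t:{u..pi}|lebesgue. \<omega> t / t\<^sup>2)) \<le> ennreal (G u)"
      by (intro ennreal_leI) (simp add: G_def mult_ac)
    finally show ?thesis .
  qed
  have prim: "(\<integral>\<^sup>+t. ennreal (G t) * indicator {0<..u} t \<partial>lebesgue) \<le> ennreal (c * (u * G u))"
    if u: "u \<in> {0<..pi}" for u
  proof -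
    have int: "set_integrable lebesgue {0<..u} H"
      by (rule set_integrable_subset[OF Hint]) (use u in auto)
    have "(\<integral>\<^sup>+t. ennreal (G t) * indicator {0<..u} t \<partial>lebesgue)
        = (\<integral>\<^sup>+t. ennreal (C * c1 * (indicator {0<..u} t *\<^sub>R H t)) \<partial>lebesgue)"
      by (intro nn_integral_cong) (auto simp: G_def split: split_indicator)
    also have "\<dots> = ennreal (LINT t|lebesgue. C * c1 * (indicator {0<..u} t *\<^sub>R H t))"
    proof (intro nn_integral_eq_integral AE_I2)
      show "integrable lebesgue (\<lambda>t. C * c1 * (indicator {0<..u} t *\<^sub>R H t))"
        using int unfolding set_integrable_def by (rule integrable_mult_right)
      show "0 \<le> C * c1 * (indicator {0<..u} t *\<^sub>R H t)" for t
        using u C(1) c1(1) H0[of t] by (auto split: split_indicator)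
    qed
    also have "(LINT t|lebesgue. C * c1 * (indicator {0<..u} t *\<^sub>R H t))
        = C * c1 * (LINT t:{0<..u}|lebesgue. H t)"
      by (simp add: set_lebesgue_integral_def)
    also have "\<dots> \<le> C * c1 * (c * (u * H u))"
      using c(2)[OF u] H0[OF u] u C(1) c1(1) by (intro mult_left_mono) auto
    hence "ennreal (C * c1 * (LINT t:{0<..u}|lebesgue. H t)) \<le> ennreal (c * (u * G u))"
      by (intro ennreal_leI) (simp add: G_def mult_ac)
    finally show ?thesis .
  qed
  note approx = conjugate_mean_approximation[where a=a,
      OF X gX g w w0 w_mono w_lin psi G0 less_imp_le[OF c(1)] tail prim r a0 a1]
  define K where "K = ((1 + 4 * (real r)\<^sup>2) * (c + pi) + c) * (C * c1)"
  have bigo: "F \<in> O[principal UNIV](\<lambda>n. H (row_variation a n r) * row_variation a n r)"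
    if "\<And>n. 0 \<le> F n" and le: "\<And>n. F n \<le> ((1 + 4 * (real r)\<^sup>2) * (c + pi) + c) *
            (row_variation a n r * G (row_variation a n r))" for F :: "nat \<Rightarrow> real"
  proof (rule bigoI[where c=K])
    have "norm (F n) \<le> K * norm (H (row_variation a n r) * row_variation a n r)" for n
    proof -
      have "F n \<le> K * (H (row_variation a n r) * row_variation a n r)"
        using le[of n] by (simp add: K_def G_def mult_ac)
      also have "\<dots> \<le> K * norm (H (row_variation a n r) * row_variation a n r)"
        using C(1) c1(1) c(1) by (intro mult_left_mono) (auto simp: K_def)
      finally show ?thesis using that(1)[of n] by simp
    qed
    thus "eventually (\<lambda>n. norm (F n) \<le> K * norm (H (row_variation a n r) * row_variation a n r))
           (principal UNIV)"
      by (simp add: eventually_principal)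
  qed
  show ?thesis
    unfolding same
  proof (intro conjI allI)
    show "holds_in X (\<lambda>x. \<exists>L. ((\<lambda>\<epsilon>. conj_trunc g x \<epsilon>) \<longlongrightarrow> L) (at_right 0))"
      by (rule approx(1))
    show "holds_in X (\<lambda>x. summable (\<lambda>k. a n k * conj_partial_sum k g x))" for n
      by (rule approx(2))
    show "(\<lambda>x. conj_mean a n g x - conj_fun g x) \<in> carrier_of X" for n
      using approx(3)[of n] by blast
    show "(\<lambda>x. conj_mean a n g x - conj_trunc g x (1 / real r * row_variation a n r)) \<in> carrier_of X" for n
      using approx(4)[of n] by blast
    show "(\<lambda>n. norm_of X (\<lambda>x. conj_mean a n g x - conj_fun g x))
      \<in> O[principal UNIV](\<lambda>n. H (row_variation a n r) * row_variation a n r)"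
      by (intro bigo norm_of_nonneg conjunct1[OF approx(3)] conjunct2[OF approx(3)])
    show "(\<lambda>n. norm_of X (\<lambda>x. conj_mean a n g x - conj_trunc g x (1 / real r * row_variation a n r)))
      \<in> O[principal UNIV](\<lambda>n. H (row_variation a n r) * row_variation a n r)"
      by (intro bigo norm_of_nonneg conjunct1[OF approx(4)] conjunct2[OF approx(4)])
  qed
qed

end
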